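(* For every $n$ and every $A\in\mathrm{GL}_n(\mathbb{R})$, there is a probability measure $\mathrm{Vol}(A)$ on permutations $(\pi_1,\ldots,\pi_n)$ of $\{1,\ldots,n\}$ (equivalently, on permutation matrices $P$) whose marginals satisfy, for every $k\in\{1,\ldots,n\}$ and every $S\subseteq\{1,\ldots,n\}$ with $|S|=k$, $$\Pr(\{\pi_1,\ldots,\pi_k\}=S)\propto(\det A[S,\{1,\ldots,k\}])^2,$$ and such that if $P\sim\mathrm{Vol}(A)$, then $PA=LU$ (the LU factorization of $PA$) satisfies $$\mathbb{E}\|L\|_F^2\le\frac{n^3+5n}6\qquad\text{and}\qquad\mathbb{E}\|U\|_F^2\le\frac{n^3+3n^2+2n}6\,\|A\|_{1\to2}^2.$$ Additionally, $\mathbb{E}\,\mathrm{growth}(PA)^2\le\frac{n^4}6+O(n^3)$, where the constant in $O(n^3)$ is absolute.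
   Context: $A[S,T]$ is the submatrix of $A$ with rows indexed by $S$ and columns indexed by $T$. A permutation $(\pi_1,\ldots,\pi_n)$ is identified with the permutation matrix $P$ with $\mathbf e_j^\top P\mathbf e_{\pi_j}=1$ for all $j$ (so row $j$ of $PA$ is row $\pi_j$ of $A$). "$\propto$" means equal up to a normalizing constant independent of $S$ (for fixed $k$). $\|\cdot\|_F$ is the Frobenius norm, $\|A\|_{1\to2}$ is the maximum Euclidean norm of a column of $A$, $\|M\|_{\max}=\max_{i,j}|M_{ij}|$. LU factorization: $B=LU$ with $L$ unit lower triangular and $U$ upper triangular (unique for non-singular $B$ if it exists; part of the claim is that $PA$ has one with probability one). $\mathrm{growth}(B)=\max\{\|L\|_{\max},\|U\|_{\max}/\|B\|_{\max}\}$, with $\mathrm{growth}(B)=+\infty$ if no LU factorization exists. *)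

theory Defs
  imports
    "HOL-Probability.Probability_Mass_Function"
    "Jordan_Normal_Form.Determinant"
    "Jordan_Normal_Form.DL_Submatrix"
begin

(* Indices are 0-based: the index set is {..<n}, and a permutation is a function pi with
   pi permutes {..<n}, whose value pi i is the row of A placed in row i of P * A. *)

definition perm_mat :: "nat \<Rightarrow> (nat \<Rightarrow> nat) \<Rightarrow> real mat" where
  "perm_mat n \<pi> = mat n n (\<lambda>(i, j). if j = \<pi> i then 1 else 0)"

definition frob_norm :: "real mat \<Rightarrow> real" where
  "frob_norm A = sqrt (\<Sum>i<dim_row A. \<Sum>j<dim_col A. (A $$ (i, j))\<^sup>2)"

(* The inserted 0 only matters for empty matrices, where Max would be unspecified. *)

definition max_norm :: "real mat \<Rightarrow> real" where
  "max_norm A = Max (insert 0 (abs ` elements_mat A))"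

definition norm_1_2 :: "real mat \<Rightarrow> real" where
  "norm_1_2 A = Max (insert 0 ((\<lambda>j. sqrt (\<Sum>i<dim_row A. (A $$ (i, j))\<^sup>2)) ` {..<dim_col A}))"

definition unit_lower_triangular :: "real mat \<Rightarrow> bool" where
  "unit_lower_triangular L \<longleftrightarrow>
     (\<forall>i<dim_row L. L $$ (i, i) = 1 \<and> (\<forall>j<dim_col L. i < j \<longrightarrow> L $$ (i, j) = 0))"

definition is_LU :: "real mat \<Rightarrow> real mat \<Rightarrow> real mat \<Rightarrow> bool" where
  "is_LU B L U \<longleftrightarrow>
     L \<in> carrier_mat (dim_row B) (dim_row B) \<and> U \<in> carrier_mat (dim_row B) (dim_row B) \<and>
     unit_lower_triangular L \<and> upper_triangular U \<and> B = L * U"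

definition has_LU :: "real mat \<Rightarrow> bool" where
  "has_LU B \<longleftrightarrow> (\<exists>L U. is_LU B L U)"

(* The factors are determined by B, and so these descriptions denote, when B is non-singular
   and has an LU factorization; otherwise their values are unspecified. *)

definition LU_L :: "real mat \<Rightarrow> real mat" where
  "LU_L B = (THE L. \<exists>U. is_LU B L U)"

definition LU_U :: "real mat \<Rightarrow> real mat" where
  "LU_U B = (THE U. \<exists>L. is_LU B L U)"

definition growth :: "real mat \<Rightarrow> ennreal" where
  "growth B =
     (if has_LU B then ennreal (max (max_norm (LU_L B)) (max_norm (LU_U B) / max_norm B)) else \<infinity>)"

end

theory Submission
  imports Defs
begin

text \<open>
  Let \<open>a 0, a 1, \<dots>\<close> be the columns of the matrix. The prescribed law of the first
  \<open>k\<close> pivot rows is the determinantal measure whose weights are the squared coordinates of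
  \<open>a (k - 1) \<and> \<dots> \<and> a 0\<close> in the exterior algebra, since these coordinates are, up to sign, the
  maximal minors of the first \<open>k\<close> columns.

  The measure exists because consecutive laws can be coupled by nested sets. By Strassen's theorem
  (\<open>rel_pmf_if_measure_le\<close>, a weighted Hall theorem) it suffices that any family of
  \<open>k\<close>-sets is at most as likely as the family of its supersets with one more element. This is
  Lyons' stochastic domination, proved in \<open>wedge_domination\<close> from the anticommutation relation
  between exterior multiplication and contraction. Gluing the couplings yields a random permutation
  all of whose prefix sets have the right law (\<open>nested_volume_sampling_exists\<close>).

  Almost surely all leading minors of the row-permuted matrix are nonzero, so that elimination
  succeeds, and the entries of both factors are ratios of bordered minors to leading minors
  (\<open>elim_square_eq_wedge\<close>). The unknown joint law of two consecutive prefix sets is at most either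
  of its marginals. For the lower factor, bounding by the law of the larger set cancels the
  denominators and leaves a count of exchanges: column \<open>k\<close>, counted from 1, contributes at most
  \<open>k (n - k)\<close> below the diagonal (\<open>expectation_L_column\<close>). For the upper factor, bounding by
  the law of the smaller set leaves \<open>k\<close> times the squared norm of a column for each entry of row
  \<open>k\<close> (\<open>expectation_U_entry\<close>). Summing over \<open>k\<close> gives the two cubic polynomials. The growth bound
  follows because the maximum norm is at most the Frobenius norm, and because a column of an
  \<open>n \<times> n\<close> matrix has squared norm at most \<open>n\<close> times its squared maximum norm.
\<close>

section \<open>Transport plans and Strassen's theorem for finite supports\<close>

definition nbrs :: "('a \<Rightarrow> 'b \<Rightarrow> bool) \<Rightarrow> 'b set \<Rightarrow> 'a set \<Rightarrow> 'b set" where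
  "nbrs R Y A = {y \<in> Y. \<exists>x\<in>A. R x y}"

definition hall_condition ::
  "('a \<Rightarrow> 'b \<Rightarrow> bool) \<Rightarrow> 'a set \<Rightarrow> 'b set \<Rightarrow> ('a \<Rightarrow> real) \<Rightarrow> ('b \<Rightarrow> real) \<Rightarrow> bool" where
  "hall_condition R X Y p r \<longleftrightarrow> (\<forall>A\<subseteq>X. sum p A \<le> sum r (nbrs R Y A))"

text \<open>
  The targets are capacities and need not be filled. Then the two parts of a problem that is split along
  a tight set of sources are again problems of the same kind.
\<close>

definition transport_plan ::
  "('a \<Rightarrow> 'b \<Rightarrow> bool) \<Rightarrow> 'a set \<Rightarrow> 'b set \<Rightarrow> ('a \<Rightarrow> real) \<Rightarrow> ('b \<Rightarrow> real) \<Rightarrow> ('a \<Rightarrow> 'b \<Rightarrow> real) \<Rightarrow> bool" where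
  "transport_plan R X Y p r f \<longleftrightarrow>
     (\<forall>x y. 0 \<le> f x y) \<and> (\<forall>x y. f x y \<noteq> 0 \<longrightarrow> x \<in> X \<and> y \<in> Y \<and> R x y) \<and>
     (\<forall>x\<in>X. (\<Sum>y\<in>Y. f x y) = p x) \<and> (\<forall>y\<in>Y. (\<Sum>x\<in>X. f x y) \<le> r y)"

lemma transport_plan_Un:
  assumes fin: "finite X" "finite Y" and X: "X = X1 \<union> X2" "X1 \<inter> X2 = {}" and Y: "Y = Y1 \<union> Y2" "Y1 \<inter> Y2 = {}"
    and f: "transport_plan R X1 Y1 p r f" and g: "transport_plan R X2 Y2 p r g"
  shows "transport_plan R X Y p r (\<lambda>x y. f x y + g x y)"
proof -
  have fin': "finite X1" "finite X2" "finite Y1" "finite Y2" using fin X Y by auto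
  have f0: "f x y = 0" if "x \<notin> X1 \<or> y \<notin> Y1" for x y using f that unfolding transport_plan_def by metis
  have g0: "g x y = 0" if "x \<notin> X2 \<or> y \<notin> Y2" for x y using g that unfolding transport_plan_def by metis
  have disj: "\<And>x. x \<in> X1 \<Longrightarrow> x \<notin> X2" "\<And>x. x \<in> Y1 \<Longrightarrow> x \<notin> Y2" using X Y by auto
  have row: "(\<Sum>y\<in>Y. f x y + g x y) = (\<Sum>y\<in>Y1. f x y) + (\<Sum>y\<in>Y2. g x y)" for x
  proof -
    have "(\<Sum>y\<in>Y. f x y) = (\<Sum>y\<in>Y1. f x y)"
      by (rule sum.mono_neutral_right) (use fin Y f0 in auto)
    moreover have "(\<Sum>y\<in>Y. g x y) = (\<Sum>y\<in>Y2. g x y)"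
      by (rule sum.mono_neutral_right) (use fin Y g0 in auto)
    ultimately show ?thesis by (simp add: sum.distrib)
  qed
  have col: "(\<Sum>x\<in>X. f x y + g x y) = (\<Sum>x\<in>X1. f x y) + (\<Sum>x\<in>X2. g x y)" for y
  proof -
    have "(\<Sum>x\<in>X. f x y) = (\<Sum>x\<in>X1. f x y)"
      by (rule sum.mono_neutral_right) (use fin X f0 in auto)
    moreover have "(\<Sum>x\<in>X. g x y) = (\<Sum>x\<in>X2. g x y)"
      by (rule sum.mono_neutral_right) (use fin X g0 in auto)
    ultimately show ?thesis by (simp add: sum.distrib)
  qed
  show ?thesis
    unfolding transport_plan_def
  proof (intro conjI allI ballI impI)
    show "0 \<le> f x y + g x y" for x y using f g unfolding transport_plan_def by (simp add: add_nonneg_nonneg)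
    show "x \<in> X" "y \<in> Y" "R x y" if "f x y + g x y \<noteq> 0" for x y
    proof -
      have "f x y \<noteq> 0 \<or> g x y \<noteq> 0" using that by auto
      then show "x \<in> X" "y \<in> Y" "R x y" using f g X Y unfolding transport_plan_def by blast+
    qed
    show "(\<Sum>y\<in>Y. f x y + g x y) = p x" if "x \<in> X" for x
    proof (cases "x \<in> X1")
      case True
      then have "(\<Sum>y\<in>Y2. g x y) = 0" using disj g0 by (intro sum.neutral) auto
      then show ?thesis using True f unfolding row transport_plan_def by auto
    next
      case False
      then have "(\<Sum>y\<in>Y1. f x y) = 0" using f0 by (intro sum.neutral) auto
      then show ?thesis using False that X g unfolding row transport_plan_def by auto
    qed
    show "(\<Sum>x\<in>X. f x y + g x y) \<le> r y" if "y \<in> Y" for y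
    proof (cases "y \<in> Y1")
      case True
      then have "(\<Sum>x\<in>X2. g x y) = 0" using disj g0 by (intro sum.neutral) auto
      then show ?thesis using True f unfolding col transport_plan_def by auto
    next
      case False
      then have "(\<Sum>x\<in>X1. f x y) = 0" using f0 by (intro sum.neutral) auto
      then show ?thesis using False that Y g unfolding col transport_plan_def by auto
    qed
  qed
qed

text \<open>
  A tight set has to use up the whole weight of its neighbours, so the problem falls apart: what lies
  outside the tight set has to be served by the remaining targets, and the union of \<open>A\<close> with any
  \<open>B\<close> outside it shows that these suffice.
\<close>

lemma hall_condition_tight:
  assumes fin: "finite X" "finite Y" and hall: "hall_condition R X Y p r"
    and A: "A \<subseteq> X" and tight: "sum p A = sum r (nbrs R Y A)"
  shows "hall_condition R A (nbrs R Y A) p r" "hall_condition R (X - A) (Y - nbrs R Y A) p r"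
proof -
  have "nbrs R (nbrs R Y A) B = nbrs R Y B" if "B \<subseteq> A" for B
    using that by (auto simp: nbrs_def)
  then show "hall_condition R A (nbrs R Y A) p r"
    using hall A unfolding hall_condition_def by (metis order_trans)
  show "hall_condition R (X - A) (Y - nbrs R Y A) p r"
    unfolding hall_condition_def
  proof (intro allI impI)
    fix B assume B: "B \<subseteq> X - A"
    have finAB: "finite A" "finite B" using A B fin by (auto intro: finite_subset)
    have finN: "finite (nbrs R Y C)" for C using fin by (auto simp: nbrs_def)
    have "sum p A + sum p B = sum p (A \<union> B)"
      using finAB B by (intro sum.union_disjoint[symmetric]) auto
    also have "\<dots> \<le> sum r (nbrs R Y (A \<union> B))"
      using hall A B unfolding hall_condition_def by (metis Diff_subset Un_subset_iff order_trans)
    also have "nbrs R Y (A \<union> B) = nbrs R Y A \<union> nbrs R (Y - nbrs R Y A) B"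
      by (auto simp: nbrs_def)
    also have "sum r \<dots> = sum r (nbrs R Y A) + sum r (nbrs R (Y - nbrs R Y A) B)"
    proof (rule sum.union_disjoint)
      show "finite (nbrs R (Y - nbrs R Y A) B)" using fin by (auto simp: nbrs_def)
    qed (use finN in \<open>auto simp: nbrs_def\<close>)
    finally show "sum p B \<le> sum r (nbrs R (Y - nbrs R Y A) B)" using tight by simp
  qed
qed

text \<open>
  The supply-demand theorem, by the Halmos-Vaughan argument. Push as much weight as possible along one
  edge without violating the condition: then the source is exhausted, or the target is exhausted, or
  some set of sources that avoids this source becomes tight. In each case the problem decomposes
  into smaller ones.
\<close>

lemma transport_plan_exists:
  assumes "finite X" "finite Y" "\<And>x. x \<in> X \<Longrightarrow> 0 \<le> p x" "\<And>y. y \<in> Y \<Longrightarrow> 0 \<le> r y"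
    and "hall_condition R X Y p r"
  shows "\<exists>f. transport_plan R X Y p r f"
  using assms
proof (induction "card X + card Y" arbitrary: X Y p r rule: less_induct)
  case less
  note fin = less.prems(1,2)
  have finN: "finite (nbrs R Y' C)" if "finite Y'" for Y' C using that by (auto simp: nbrs_def)
  (* A pair of weights with an exhausted source, an exhausted target or a tight proper subset splits
     into problems with fewer points in total, to which the induction hypothesis applies. *)
  have split: "\<exists>f. transport_plan R X Y p' r' f"
    if p': "\<And>x. x \<in> X \<Longrightarrow> 0 \<le> p' x" and r': "\<And>y. y \<in> Y \<Longrightarrow> 0 \<le> r' y"
      and hall: "hall_condition R X Y p' r'"
      and crit: "(\<exists>x\<in>X. p' x = 0) \<or> (\<exists>y\<in>Y. r' y = 0) \<or>
        (\<exists>A\<subset>X. A \<noteq> {} \<and> sum p' A = sum r' (nbrs R Y A))" for p' r'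
    using crit
  proof (elim disjE bexE exE conjE)
    fix x assume x: "x \<in> X" "p' x = 0"
    have "hall_condition R (X - {x}) Y p' r'"
      using hall unfolding hall_condition_def by blast
    moreover have "card (X - {x}) < card X" using x fin by (metis card_Diff1_less)
    ultimately obtain f where f: "transport_plan R (X - {x}) Y p' r' f"
      using less.hyps[of "X - {x}" Y p' r'] p' r' fin by auto
    have g: "transport_plan R {x} {} p' r' (\<lambda>_ _. 0)" using x by (simp add: transport_plan_def)
    show ?thesis
      using transport_plan_Un[OF fin _ _ _ _ f g] x by (auto simp: insert_absorb)
  next
    fix y assume y: "y \<in> Y" "r' y = 0"
    have "hall_condition R X (Y - {y}) p' r'"
      unfolding hall_condition_def
    proof (intro allI impI)
      fix A assume "A \<subseteq> X"
      then have "sum p' A \<le> sum r' (nbrs R Y A)" using hall by (auto simp: hall_condition_def)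
      also have "\<dots> = sum r' (nbrs R (Y - {y}) A)"
        by (rule sum.mono_neutral_right) (use finN fin y in \<open>auto simp: nbrs_def\<close>)
      finally show "sum p' A \<le> sum r' (nbrs R (Y - {y}) A)" .
    qed
    moreover have "card (Y - {y}) < card Y" using y fin by (metis card_Diff1_less)
    ultimately obtain f where f: "transport_plan R X (Y - {y}) p' r' f"
      using less.hyps[of X "Y - {y}" p' r'] p' r' fin by auto
    have g: "transport_plan R {} {y} p' r' (\<lambda>_ _. 0)" using y by (simp add: transport_plan_def)
    show ?thesis
      using transport_plan_Un[OF fin _ _ _ _ f g] y by (auto simp: insert_absorb)
  next
    fix A assume A: "A \<subset> X" "A \<noteq> {}" and tight: "sum p' A = sum r' (nbrs R Y A)"
    have AX: "A \<subseteq> X" using A by auto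
    have NY: "nbrs R Y A \<subseteq> Y" by (auto simp: nbrs_def)
    have finA: "finite A" using AX fin finite_subset by auto
    note H = hall_condition_tight[OF fin hall AX tight]
    have cA: "card A < card X" using A fin by (simp add: psubset_card_mono)
    have cXA: "card (X - A) < card X"
      using A fin finA by (intro psubset_card_mono) auto
    have cN: "card (nbrs R Y A) \<le> card Y" "card (Y - nbrs R Y A) \<le> card Y"
      using NY fin by (auto intro: card_mono)
    obtain f where f: "transport_plan R A (nbrs R Y A) p' r' f"
      using less.hyps[of A "nbrs R Y A" p' r'] cA cN finA finN fin p' r' AX NY H(1) by (metis add_less_le_mono subsetD)
    obtain g where g: "transport_plan R (X - A) (Y - nbrs R Y A) p' r' g"
      using less.hyps[of "X - A" "Y - nbrs R Y A" p' r'] cXA cN fin p' r' H(2)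
      by (metis DiffD1 add_less_le_mono finite_Diff)
    show ?thesis
      using transport_plan_Un[OF fin _ _ _ _ f g] AX NY by blast
  qed
  show ?case
  proof (cases "(\<exists>x\<in>X. p x = 0) \<or> X = {}")
    case True
    then show ?thesis
    proof
      assume "X = {}"
      then show ?thesis using less.prems by (intro exI[of _ "\<lambda>_ _. 0"]) (auto simp: transport_plan_def)
    qed (use split less.prems in blast)
  next
    case False
    then obtain x where x: "x \<in> X" "0 < p x" using less.prems(3) by (metis antisym_conv1 equals0I)
    have "0 < sum r (nbrs R Y {x})"
      using less.prems(5) x unfolding hall_condition_def by (metis empty_subsetI finite.emptyI insert_subset less_le_trans sum.empty sum.insert add.right_neutral empty_iff)
    then have "nbrs R Y {x} \<noteq> {}" by force
    then obtain y where y: "y \<in> Y" "R x y" unfolding nbrs_def by auto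
    (* Moving weight from x to y hurts exactly the sets that see y but do not contain x. *)
    define Cut where "Cut = {A. A \<subseteq> X \<and> x \<notin> A \<and> y \<in> nbrs R Y A}"
    define slack where "slack A = sum r (nbrs R Y A) - sum p A" for A
    define t where "t = Min (insert (p x) (insert (r y) (slack ` Cut)))"
    have finCut: "finite Cut" unfolding Cut_def using fin by auto
    have t_le: "t \<le> p x" "t \<le> r y" "\<And>A. A \<in> Cut \<Longrightarrow> t \<le> slack A"
      unfolding t_def using finCut by (auto intro!: Min_le simp del: Min_insert)
    have t_in: "t = p x \<or> t = r y \<or> t \<in> slack ` Cut"
      using Min_in[of "insert (p x) (insert (r y) (slack ` Cut))"] finCut unfolding t_def by blast
    have t0: "0 \<le> t"
      unfolding t_def using finCut x y less.prems(4,5)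
      by (subst Min_ge_iff) (auto simp: slack_def Cut_def hall_condition_def)
    define p' where "p' = p(x := p x - t)"
    define r' where "r' = r(y := r y - t)"
    have sum_p': "sum p' A = sum p A - (if x \<in> A then t else 0)" if "A \<subseteq> X" for A
    proof -
      have fA: "finite A" using that fin finite_subset by auto
      have "sum p' A = (\<Sum>z\<in>A. p z - (if z = x then t else 0))"
        by (rule sum.cong) (auto simp: p'_def)
      then show ?thesis using fA by (simp add: sum_subtractf)
    qed
    have sum_r': "sum r' B = sum r B - (if y \<in> B then t else 0)" if "B \<subseteq> Y" for B
    proof -
      have fB: "finite B" using that fin finite_subset by auto
      have "sum r' B = (\<Sum>z\<in>B. r z - (if z = y then t else 0))"
        by (rule sum.cong) (auto simp: r'_def)
      then show ?thesis using fB by (simp add: sum_subtractf)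
    qed
    have NY: "nbrs R Y A \<subseteq> Y" for A by (auto simp: nbrs_def)
    have hall': "hall_condition R X Y p' r'"
      unfolding hall_condition_def
    proof (intro allI impI)
      fix A assume A: "A \<subseteq> X"
      have le: "sum p A \<le> sum r (nbrs R Y A)" using less.prems(5) A by (auto simp: hall_condition_def)
      show "sum p' A \<le> sum r' (nbrs R Y A)"
      proof (cases "x \<in> A")
        case True
        then have "y \<in> nbrs R Y A" using y by (auto simp: nbrs_def)
        then show ?thesis using True le by (simp add: sum_p'[OF A] sum_r'[OF NY])
      next
        case False
        then show ?thesis using le t_le(3)[of A] A
          by (auto simp: sum_p'[OF A] sum_r'[OF NY] slack_def Cut_def)
      qed
    qed
    (* The minimum t is attained, and each of its three kinds of candidates gives one of the cases. *)
    have crit: "(\<exists>x\<in>X. p' x = 0) \<or> (\<exists>y\<in>Y. r' y = 0) \<or>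
        (\<exists>A\<subset>X. A \<noteq> {} \<and> sum p' A = sum r' (nbrs R Y A))"
    proof -
      consider "t = p x" | "t = r y" | A where "A \<in> Cut" "t = slack A" using t_in by blast
      then show ?thesis
      proof cases
        case 1 then show ?thesis using x by (auto simp: p'_def)
      next
        case 2 then show ?thesis using y by (auto simp: r'_def)
      next
        case (3 A)
        then have A: "A \<subseteq> X" "x \<notin> A" "y \<in> nbrs R Y A" by (auto simp: Cut_def)
        then have "A \<subset> X" "A \<noteq> {}" using x by (auto simp: nbrs_def)
        moreover have "sum p' A = sum r' (nbrs R Y A)"
          using A 3 by (simp add: sum_p'[OF A(1)] sum_r'[OF NY] slack_def)
        ultimately show ?thesis by blast
      qed
    qed
    obtain f where f: "transport_plan R X Y p' r' f"
      using split[OF _ _ hall' crit] less.prems(3,4) t_le unfolding p'_def r'_def by fastforce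
    define g where "g = (\<lambda>a b. f a b + (if a = x \<and> b = y then t else 0))"
    have row: "(\<Sum>b\<in>Y. g a b) = (\<Sum>b\<in>Y. f a b) + (if a = x then t else 0)" for a
      using fin y by (simp add: g_def sum.distrib)
    have col: "(\<Sum>a\<in>X. g a b) = (\<Sum>a\<in>X. f a b) + (if b = y then t else 0)" for b
      using fin x by (simp add: g_def sum.distrib)
    have "transport_plan R X Y p r g"
      using f x y t0 unfolding transport_plan_def row col
      by (auto simp: g_def p'_def r'_def split: if_splits)
    then show ?thesis by blast
  qed
qed

text \<open>
  Strassen's theorem for finitely supported distributions, the converse of
  \<open>rel_pmf_measureD\<close>: a coupling inside \<open>R\<close> is a transport plan between the
  two mass functions.
\<close>

lemma rel_pmf_if_measure_le:
  assumes fin: "finite (set_pmf p)" "finite (set_pmf q)"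
    and le: "\<And>A. A \<subseteq> set_pmf p \<Longrightarrow> measure p A \<le> measure q {y. \<exists>x\<in>A. R x y}"
  shows "rel_pmf R p q"
proof -
  let ?X = "set_pmf p" and ?Y = "set_pmf q"
  have "hall_condition R ?X ?Y (pmf p) (pmf q)"
    unfolding hall_condition_def
  proof (intro allI impI)
    fix A assume A: "A \<subseteq> ?X"
    then have fA: "finite A" using fin finite_subset by auto
    have fN: "finite (nbrs R ?Y A)" using fin by (auto simp: nbrs_def)
    have "sum (pmf p) A = measure p A" using fA by (simp add: measure_measure_pmf_finite)
    also have "\<dots> \<le> measure q {y. \<exists>x\<in>A. R x y}" by (rule le[OF A])
    also have "\<dots> = measure q ({y. \<exists>x\<in>A. R x y} \<inter> ?Y)" by (simp add: measure_Int_set_pmf)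
    also have "{y. \<exists>x\<in>A. R x y} \<inter> ?Y = nbrs R ?Y A" by (auto simp: nbrs_def)
    also have "measure q \<dots> = sum (pmf q) (nbrs R ?Y A)"
      using fN by (simp add: measure_measure_pmf_finite)
    finally show "sum (pmf p) A \<le> sum (pmf q) (nbrs R ?Y A)" .
  qed
  then obtain f where f: "transport_plan R ?X ?Y (pmf p) (pmf q) f"
    using transport_plan_exists[OF fin] by (metis pmf_nonneg)
  have f_nonneg: "0 \<le> f x y" for x y using f by (auto simp: transport_plan_def)
  have f_supp: "x \<in> ?X \<and> y \<in> ?Y \<and> R x y" if "f x y \<noteq> 0" for x y
    using f that unfolding transport_plan_def by blast
  have f_row: "(\<Sum>y\<in>?Y. f x y) = pmf p x" if "x \<in> ?X" for x
    using f that by (auto simp: transport_plan_def)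
  have total: "(\<Sum>x\<in>?X. \<Sum>y\<in>?Y. f x y) = 1"
    using f_row fin by (simp add: sum_pmf_eq_1)
  (* No mass is lost, so the column bounds are equalities. *)
  have f_col: "(\<Sum>x\<in>?X. f x y) = pmf q y" if "y \<in> ?Y" for y
  proof (rule ccontr)
    assume ne: "(\<Sum>x\<in>?X. f x y) \<noteq> pmf q y"
    have le: "(\<Sum>x\<in>?X. f x z) \<le> pmf q z" if "z \<in> ?Y" for z
      using f that by (auto simp: transport_plan_def)
    have "(\<Sum>z\<in>?Y. \<Sum>x\<in>?X. f x z) < (\<Sum>z\<in>?Y. pmf q z)"
      using fin le ne that by (intro sum_strict_mono_ex1) (auto simp: less_le)
    also have "\<dots> = 1" using fin by (simp add: sum_pmf_eq_1)
    also have "\<dots> = (\<Sum>z\<in>?Y. \<Sum>x\<in>?X. f x z)" using total by (subst sum.swap) simp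
    finally show False by simp
  qed
  define h where "h = (\<lambda>(x, y). f x y)"
  have h_total: "(\<integral>\<^sup>+z. ennreal (h z) \<partial>count_space UNIV) = 1"
  proof -
    have "(\<integral>\<^sup>+z. ennreal (h z) \<partial>count_space UNIV) = (\<Sum>z\<in>?X \<times> ?Y. ennreal (h z))"
      using fin f_supp by (intro nn_integral_count_space') (auto simp: h_def, (metis ennreal_0)+)
    also have "\<dots> = ennreal (\<Sum>z\<in>?X \<times> ?Y. h z)"
      using f_nonneg by (intro sum_ennreal) (auto simp: h_def)
    also have "(\<Sum>z\<in>?X \<times> ?Y. h z) = 1"
      using total by (simp add: h_def sum.cartesian_product)
    finally show ?thesis by simp
  qed
  define pq where "pq = embed_pmf h"
  have pmf_pq: "pmf pq z = h z" for z
    unfolding pq_def using f_nonneg h_total by (intro pmf_embed_pmf) (auto simp: h_def)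
  have set_pq: "set_pmf pq \<subseteq> ?X \<times> ?Y"
    using f_supp by (auto simp: set_pmf_eq pmf_pq h_def)
  show ?thesis
  proof (rule rel_pmf.intros)
    show "R x y" if "(x, y) \<in> set_pmf pq" for x y
      using that f_supp by (auto simp: set_pmf_eq pmf_pq h_def)
    show "map_pmf fst pq = p"
    proof (rule pmf_eqI)
      fix x
      have "pmf (map_pmf fst pq) x = measure pq ((fst -` {x}) \<inter> set_pmf pq)"
        by (simp add: pmf_map measure_Int_set_pmf)
      also have "\<dots> = measure pq (({x} \<times> ?Y) \<inter> set_pmf pq)"
        using set_pq by (intro arg_cong[where f = "measure pq"]) auto
      also have "\<dots> = (\<Sum>y\<in>?Y. f x y)"
        using fin by (simp add: measure_Int_set_pmf measure_measure_pmf_finite pmf_pq h_def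
            flip: sum.cartesian_product)
      also have "\<dots> = pmf p x"
        using f_row f_supp by (cases "x \<in> ?X") (auto simp: set_pmf_iff intro!: sum.neutral)
      finally show "pmf (map_pmf fst pq) x = pmf p x" .
    qed
    show "map_pmf snd pq = q"
    proof (rule pmf_eqI)
      fix y
      have "pmf (map_pmf snd pq) y = measure pq ((snd -` {y}) \<inter> set_pmf pq)"
        by (simp add: pmf_map measure_Int_set_pmf)
      also have "\<dots> = measure pq ((?X \<times> {y}) \<inter> set_pmf pq)"
        using set_pq by (intro arg_cong[where f = "measure pq"]) auto
      also have "\<dots> = (\<Sum>x\<in>?X. f x y)"
        using fin by (simp add: measure_Int_set_pmf measure_measure_pmf_finite pmf_pq h_def
            flip: sum.cartesian_product)
      also have "\<dots> = pmf q y"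
        using f_col f_supp by (cases "y \<in> ?Y") (auto simp: set_pmf_iff intro!: sum.neutral)
      finally show "pmf (map_pmf snd pq) y = pmf q y" .
    qed
  qed
qed

section \<open>Exterior algebra in coordinates\<close>

text \<open>
  A multivector, an element of the exterior algebra of \<open>\<real>\<^sup>I\<close>, is represented by its coordinates: the value at
  a finite set \<open>S\<close> is the coefficient of the wedge product of the basis vectors with
  indices in \<open>S\<close>, in increasing order. Then \<open>ext_mul a\<close> is left multiplication by
  the vector \<open>a\<close> and \<open>contract I a\<close> is its adjoint, the interior product. The
  sign is the one that moves the factor with index \<open>i\<close> from the front to its place.
\<close>

definition ext_sign :: "nat \<Rightarrow> nat set \<Rightarrow> real" where
  "ext_sign i T = (-1) ^ card {t \<in> T. t < i}"

definition ext_mul :: "(nat \<Rightarrow> real) \<Rightarrow> (nat set \<Rightarrow> real) \<Rightarrow> nat set \<Rightarrow> real" where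
  "ext_mul a v S = (\<Sum>i\<in>S. ext_sign i S * a i * v (S - {i}))"

definition contract :: "nat set \<Rightarrow> (nat \<Rightarrow> real) \<Rightarrow> (nat set \<Rightarrow> real) \<Rightarrow> nat set \<Rightarrow> real" where
  "contract I a v T = (\<Sum>i\<in>I - T. ext_sign i T * a i * v (insert i T))"

definition dot :: "nat set \<Rightarrow> (nat \<Rightarrow> real) \<Rightarrow> (nat \<Rightarrow> real) \<Rightarrow> real" where
  "dot I a b = (\<Sum>i\<in>I. a i * b i)"

text \<open>
  \<open>wedge a k\<close> is the product of \<open>a (k - 1), \<dots>, a 0\<close> in this order.
\<close>

fun wedge :: "(nat \<Rightarrow> nat \<Rightarrow> real) \<Rightarrow> nat \<Rightarrow> nat set \<Rightarrow> real" where
  "wedge a 0 = (\<lambda>S. if S = {} then 1 else 0)"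
| "wedge a (Suc k) = ext_mul (a k) (wedge a k)"

lemma ext_sign_square: "ext_sign i T * ext_sign i T = 1"
  by (simp add: ext_sign_def flip: power_mult_distrib)

lemma ext_sign_insert_self: "ext_sign i (insert i T) = ext_sign i T"
  unfolding ext_sign_def by (rule arg_cong[where f = "\<lambda>A. (-1) ^ card A"]) auto

lemma ext_sign_remove_self: "ext_sign i (T - {i}) = ext_sign i T"
  unfolding ext_sign_def by (rule arg_cong[where f = "\<lambda>A. (-1) ^ card A"]) auto

lemma ext_sign_insert:
  assumes "finite T" "i \<notin> T"
  shows "ext_sign j (insert i T) = (if i < j then - ext_sign j T else ext_sign j T)"
proof -
  have "{t \<in> insert i T. t < j} = (if i < j then insert i {t \<in> T. t < j} else {t \<in> T. t < j})"
    by auto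
  then show ?thesis using assms by (auto simp: ext_sign_def)
qed

text \<open>
  This sign rule is the source of both anticommutation relations below: exactly one of the two indices
  is the larger one, and inserting the smaller one flips its sign.
\<close>

lemma ext_sign_swap:
  assumes "finite T" "i \<notin> T" "j \<notin> T" "i \<noteq> j"
  shows "ext_sign i T * ext_sign j (insert i T) = - (ext_sign j T * ext_sign i (insert j T))"
  using assms by (auto simp: ext_sign_insert)

lemma ext_mul_anticommute: "ext_mul a (ext_mul b v) S = - ext_mul b (ext_mul a v) S"
proof (cases "finite S")
  case False then show ?thesis by (simp add: ext_mul_def)
next
  case True
  define F where "F a b i j = ext_sign i S * ext_sign j (S - {i}) * a i * b j * v (S - {i} - {j})"
    for a b :: "nat \<Rightarrow> real" and i j
  have E: "ext_mul a (ext_mul b v) S = (\<Sum>i\<in>S. \<Sum>j\<in>S - {i}. F a b i j)" for a b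
    by (simp add: ext_mul_def F_def sum_distrib_left sum_distrib_right mult_ac)
  have F: "F a b i j = - F b a j i" if "i \<in> S" "j \<in> S" "i \<noteq> j" for i j
  proof -
    define T where "T = S - {i} - {j}"
    have S: "S = insert i (insert j T)" "S - {i} = insert j T" "S - {j} = insert i T" "S - {j} - {i} = T"
      and T: "finite T" "i \<notin> T" "j \<notin> T" using that True by (auto simp: T_def)
    have "ext_sign i S * ext_sign j (S - {i}) = - (ext_sign j S * ext_sign i (S - {j}))"
    proof -
      have "ext_sign i S = ext_sign i (insert j T)" "ext_sign j S = ext_sign j (insert i T)"
        using ext_sign_remove_self[of i S] ext_sign_remove_self[of j S] S(2,3) by simp_all
      moreover have "ext_sign j (insert j T) = ext_sign j T" "ext_sign i (insert i T) = ext_sign i T"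
        by (simp_all add: ext_sign_insert_self)
      ultimately show ?thesis
        unfolding S(2,3) using ext_sign_swap[OF T \<open>i \<noteq> j\<close>] by (simp add: mult.commute)
    qed
    then show ?thesis unfolding F_def S(4) T_def[symmetric] by (simp add: algebra_simps)
  qed
  have "ext_mul a (ext_mul b v) S = (\<Sum>i\<in>S. \<Sum>j | j \<in> S \<and> i \<noteq> j. F a b i j)"
    unfolding E by (intro sum.cong refl) auto
  also have "\<dots> = (\<Sum>j\<in>S. \<Sum>i | i \<in> S \<and> i \<noteq> j. F a b i j)"
    using True by (intro sum.swap_restrict)
  also have "\<dots> = (\<Sum>j\<in>S. \<Sum>i\<in>S - {j}. - F b a j i)"
    by (intro sum.cong) (auto intro!: F)
  also have "\<dots> = - ext_mul b (ext_mul a v) S" unfolding E by (simp add: sum_negf)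
  finally show ?thesis .
qed

lemma ext_mul_self: "ext_mul a (ext_mul a v) = (\<lambda>S. 0)"
  using ext_mul_anticommute[of a a v] by (auto simp: fun_eq_iff)

lemma ext_mul_lincomb: "ext_mul (\<lambda>i. a i - c * b i) v S = ext_mul a v S - c * ext_mul b v S"
  by (simp add: ext_mul_def sum_subtractf sum_distrib_left algebra_simps)

lemma contract_lincomb: "contract I (\<lambda>i. a i - c * b i) v T = contract I a v T - c * contract I b v T"
  by (simp add: contract_def sum_subtractf sum_distrib_left algebra_simps)

lemma dot_lincomb: "dot I (\<lambda>i. a i - c * b i) d = dot I a d - c * dot I b d"
  by (simp add: dot_def sum_subtractf sum_distrib_left algebra_simps)

lemma ext_mul_cong: "(\<And>T. T \<subseteq> S \<Longrightarrow> u T = v T) \<Longrightarrow> ext_mul a u S = ext_mul a v S"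
  unfolding ext_mul_def by (intro sum.cong) auto

text \<open>
  The canonical anticommutation relation. The terms that insert and remove the same index add up to the
  inner product; all others cancel in pairs.
\<close>

lemma contract_ext_mul:
  assumes I: "finite I" and T: "T \<subseteq> I"
  shows "contract I a (ext_mul b v) T + ext_mul b (contract I a v) T = dot I a b * v T"
proof -
  have fT: "finite T" using I T finite_subset by auto
  define F where "F i j = ext_sign i T * ext_sign j (insert i T) * a i * b j * v (insert i T - {j})" for i j
  have "contract I a (ext_mul b v) T = (\<Sum>i\<in>I - T. a i * b i * v T + (\<Sum>j\<in>T. F i j))"
    unfolding contract_def
  proof (intro sum.cong refl)
    fix i assume i: "i \<in> I - T"
    then have "ext_mul b v (insert i T) = ext_sign i T * b i * v T +
        (\<Sum>j\<in>T. ext_sign j (insert i T) * b j * v (insert i T - {j}))"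
      using fT by (simp add: ext_mul_def ext_sign_insert_self)
    moreover have "ext_sign i T * a i * (ext_sign i T * b i * v T) = a i * b i * v T"
    proof -
      have "ext_sign i T * a i * (ext_sign i T * b i * v T) = (ext_sign i T * ext_sign i T) * (a i * b i * v T)"
        by (simp only: mult_ac)
      then show ?thesis by (simp add: ext_sign_square)
    qed
    ultimately show "ext_sign i T * a i * ext_mul b v (insert i T) = a i * b i * v T + (\<Sum>j\<in>T. F i j)"
      by (simp add: F_def distrib_left sum_distrib_left mult_ac)
  qed
  moreover have "ext_mul b (contract I a v) T = (\<Sum>j\<in>T. a j * b j * v T + (\<Sum>i\<in>I - T. - F i j))"
    unfolding ext_mul_def
  proof (intro sum.cong refl)
    fix j assume j: "j \<in> T"
    define U where "U = T - {j}"
    have T': "T = insert j U" "j \<notin> U" "finite U" using j fT by (auto simp: U_def)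
    have IU: "I - U = insert j (I - T)" using j T by (auto simp: U_def)
    have "contract I a v U = ext_sign j U * a j * v T + (\<Sum>i\<in>I - T. ext_sign i U * a i * v (insert i U))"
      unfolding contract_def IU using I j by (subst sum.insert) (simp_all flip: T'(1))
    moreover have "ext_sign j T * b j * (ext_sign j U * a j * v T) = a j * b j * v T"
    proof -
      have "ext_sign j T * b j * (ext_sign j T * a j * v T) = (ext_sign j T * ext_sign j T) * (a j * b j * v T)"
        by (simp only: mult_ac)
      then show ?thesis by (simp add: ext_sign_square U_def ext_sign_remove_self)
    qed
    moreover have "ext_sign j T * b j * (ext_sign i U * a i * v (insert i U)) = - F i j" if i: "i \<in> I - T" for i
    proof -
      have "ext_sign i T * ext_sign j (insert i T) = - (ext_sign j T * ext_sign i U)"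
      proof -
        have "ext_sign i U * ext_sign j (insert i U) = - (ext_sign j U * ext_sign i T)"
          using ext_sign_swap[of U i j] i j T' by (metis Diff_iff insertCI)
        moreover have "ext_sign j (insert i U) = ext_sign j (insert i T)"
          using ext_sign_remove_self[of j "insert i T"] i j
          by (metis DiffD2 U_def insert_Diff_if singletonD)
        moreover have "ext_sign j U = ext_sign j T" unfolding U_def by (rule ext_sign_remove_self)
        ultimately have "ext_sign i U * ext_sign j (insert i T) = - (ext_sign j T * ext_sign i T)" by simp
        then have "ext_sign i U * ext_sign i U * ext_sign i T * ext_sign j (insert i T) =
            - (ext_sign j T * (ext_sign i T * ext_sign i T) * ext_sign i U)"
          by (simp add: mult_ac)
        then show ?thesis by (simp add: ext_sign_square)
      qed
      moreover have "insert i T - {j} = insert i U" using i j by (auto simp: U_def)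
      ultimately show ?thesis by (simp add: F_def algebra_simps)
    qed
    ultimately show "ext_sign j T * b j * contract I a v (T - {j}) = a j * b j * v T + (\<Sum>i\<in>I - T. - F i j)"
      by (simp add: U_def[symmetric] distrib_left sum_distrib_left)
  qed
  moreover have "(\<Sum>i\<in>I - T. \<Sum>j\<in>T. F i j) = (\<Sum>j\<in>T. \<Sum>i\<in>I - T. F i j)" by (rule sum.swap)
  moreover have "dot I a b * v T = (\<Sum>i\<in>I - T. a i * b i * v T) + (\<Sum>j\<in>T. a j * b j * v T)"
    unfolding dot_def using sum.subset_diff[OF T I, of "\<lambda>i. a i * b i"]
    by (simp add: sum_distrib_right distrib_right)
  ultimately show ?thesis by (simp add: sum.distrib sum_negf sum_subtractf)
qed

lemma sum_Pow_remove_eq_sum_Pow_insert: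
  fixes F :: "nat set \<Rightarrow> nat \<Rightarrow> real"
  assumes I: "finite I"
  shows "(\<Sum>S\<in>Pow I. \<Sum>i\<in>S. F (S - {i}) i) = (\<Sum>T\<in>Pow I. \<Sum>i\<in>I - T. F T i)"
proof -
  have fS: "finite S" if "S \<in> Pow I" for S using that I finite_subset by auto
  have "(\<Sum>S\<in>Pow I. \<Sum>i\<in>S. F (S - {i}) i) = (\<Sum>(S, i)\<in>Sigma (Pow I) (\<lambda>S. S). F (S - {i}) i)"
    using I fS by (simp add: sum.Sigma)
  also have "\<dots> = (\<Sum>(T, i)\<in>Sigma (Pow I) (\<lambda>T. I - T). F T i)"
    by (rule sum.reindex_bij_witness[where i = "\<lambda>(T, i). (insert i T, i)" and j = "\<lambda>(S, i). (S - {i}, i)"])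
      auto
  also have "\<dots> = (\<Sum>T\<in>Pow I. \<Sum>i\<in>I - T. F T i)"
    using I by (simp add: sum.Sigma)
  finally show ?thesis .
qed

lemma ext_mul_adjoint:
  assumes I: "finite I"
  shows "(\<Sum>S\<in>Pow I. ext_mul a v S * u S) = (\<Sum>T\<in>Pow I. v T * contract I a u T)"
proof -
  have "(\<Sum>S\<in>Pow I. ext_mul a v S * u S) =
      (\<Sum>S\<in>Pow I. \<Sum>i\<in>S. ext_sign i (S - {i}) * a i * v (S - {i}) * u (insert i (S - {i})))"
    unfolding ext_mul_def
    by (simp add: sum_distrib_right ext_sign_remove_self insert_absorb)
  also have "\<dots> = (\<Sum>T\<in>Pow I. \<Sum>i\<in>I - T. ext_sign i T * a i * v T * u (insert i T))"
    by (rule sum_Pow_remove_eq_sum_Pow_insert[OF I])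
  also have "\<dots> = (\<Sum>T\<in>Pow I. v T * contract I a u T)"
    unfolding contract_def by (simp add: sum_distrib_left mult_ac)
  finally show ?thesis .
qed

text \<open>
  If \<open>u\<close> is a product of vectors orthogonal to \<open>q\<close>, multiplication by \<open>q\<close>
  preserves the inner product with \<open>u\<close> up to the factor \<open>\<parallel>q\<parallel>\<^sup>2\<close>, for any multivector
  \<open>v\<close> and not only for products. This is what makes the domination lemma work, where
  \<open>v\<close> is a coordinate projection of \<open>u\<close>.
\<close>

lemma ext_mul_inner_of_contract_0:
  assumes I: "finite I" and u: "\<And>T. T \<subseteq> I \<Longrightarrow> contract I q u T = 0"
  shows "(\<Sum>S\<in>Pow I. ext_mul q v S * ext_mul q u S) = dot I q q * (\<Sum>T\<in>Pow I. v T * u T)"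
proof -
  have "contract I q (ext_mul q u) T = dot I q q * u T" if "T \<subseteq> I" for T
  proof -
    have "ext_mul q (contract I q u) T = 0" 
    proof -
      have "contract I q u (T - {i}) = 0" for i using that by (intro u) auto
      then show ?thesis by (simp add: ext_mul_def)
    qed
    then show ?thesis using contract_ext_mul[OF I that, of q q u] by simp
  qed
  then show ?thesis
    unfolding ext_mul_adjoint[OF I] by (simp add: sum_distrib_left mult_ac)
qed

lemma ext_mul_norm_le:
  assumes I: "finite I"
  shows "(\<Sum>S\<in>Pow I. (ext_mul a v S)\<^sup>2) \<le> dot I a a * (\<Sum>T\<in>Pow I. (v T)\<^sup>2)"
proof -
  have "(\<Sum>S\<in>Pow I. (ext_mul a v S)\<^sup>2) = (\<Sum>T\<in>Pow I. v T * contract I a (ext_mul a v) T)"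
    unfolding power2_eq_square by (rule ext_mul_adjoint[OF I])
  also have "\<dots> = (\<Sum>T\<in>Pow I. dot I a a * (v T)\<^sup>2 - v T * ext_mul a (contract I a v) T)"
  proof (intro sum.cong refl)
    fix T assume "T \<in> Pow I"
    then have "contract I a (ext_mul a v) T = dot I a a * v T - ext_mul a (contract I a v) T"
      using contract_ext_mul[OF I, of T a a v] by simp
    then show "v T * contract I a (ext_mul a v) T = dot I a a * (v T)\<^sup>2 - v T * ext_mul a (contract I a v) T"
      by (simp add: power2_eq_square right_diff_distrib mult_ac)
  qed
  also have "\<dots> = dot I a a * (\<Sum>T\<in>Pow I. (v T)\<^sup>2) - (\<Sum>T\<in>Pow I. ext_mul a (contract I a v) T * v T)"
    by (simp add: sum_subtractf sum_distrib_left mult.commute)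
  also have "\<dots> = dot I a a * (\<Sum>T\<in>Pow I. (v T)\<^sup>2) - (\<Sum>T\<in>Pow I. (contract I a v T)\<^sup>2)"
    unfolding ext_mul_adjoint[OF I] by (simp add: power2_eq_square)
  also have "\<dots> \<le> dot I a a * (\<Sum>T\<in>Pow I. (v T)\<^sup>2)" by (simp add: sum_nonneg)
  finally show ?thesis .
qed

text \<open>
  The Gram-Schmidt step: \<open>q\<close> stands for the component of \<open>b\<close> orthogonal to
  \<open>a 0, \<dots>, a (k - 1)\<close>. Stating it through its effect on \<open>wedge a k\<close> avoids
  any mention of spans; the induction removes one orthogonalised factor \<open>q\<close> at a time.
\<close>

lemma wedge_orthogonal_component:
  assumes I: "finite I"
  shows "\<exists>q. ext_mul q (wedge a k) = ext_mul b (wedge a k) \<and> (\<forall>T\<subseteq>I. contract I q (wedge a k) T = 0)"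
proof (induction k arbitrary: b)
  case 0
  show ?case by (intro exI[of _ b]) (auto simp: contract_def intro!: sum.neutral)
next
  case (Suc k)
  obtain q where q: "ext_mul q (wedge a k) = ext_mul (a k) (wedge a k)"
      "\<And>T. T \<subseteq> I \<Longrightarrow> contract I q (wedge a k) T = 0"
    using Suc by blast
  obtain b' where b': "ext_mul b' (wedge a k) = ext_mul b (wedge a k)"
      "\<And>T. T \<subseteq> I \<Longrightarrow> contract I b' (wedge a k) T = 0"
    using Suc by blast
  define c where "c = dot I b' q / dot I q q"
  define p where "p = (\<lambda>i. b' i - c * q i)"
  have W: "wedge a (Suc k) = ext_mul q (wedge a k)" using q by simp
  have orth: "dot I p q = 0"
  proof (cases "dot I q q = 0")
    case True
    then have "q i = 0" if "i \<in> I" for i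
      using that I unfolding dot_def by (subst (asm) sum_nonneg_eq_0_iff) auto
    then show ?thesis by (simp add: dot_def)
  next
    case False
    then show ?thesis unfolding p_def dot_lincomb by (simp add: c_def)
  qed
  have "ext_mul p (wedge a (Suc k)) S = ext_mul b (wedge a (Suc k)) S" for S
  proof -
    have "ext_mul p (wedge a (Suc k)) S = ext_mul b' (ext_mul q (wedge a k)) S"
      unfolding W p_def ext_mul_lincomb ext_mul_self by simp
    also have "\<dots> = - ext_mul q (ext_mul b (wedge a k)) S"
      by (simp add: ext_mul_anticommute[of b'] b'(1))
    also have "\<dots> = ext_mul b (wedge a (Suc k)) S"
      unfolding W by (simp add: ext_mul_anticommute[of b])
    finally show ?thesis .
  qed
  moreover have "contract I p (wedge a (Suc k)) T = 0" if T: "T \<subseteq> I" for T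
  proof -
    have "contract I p (wedge a k) U = 0" if "U \<subseteq> T" for U
      using q(2)[of U] b'(2)[of U] that T by (simp add: p_def contract_lincomb)
    then have "ext_mul q (contract I p (wedge a k)) T = ext_mul q (\<lambda>_. 0) T"
      by (intro ext_mul_cong) auto
    also have "\<dots> = 0" by (simp add: ext_mul_def)
    finally show ?thesis
      using contract_ext_mul[OF I T, of p q "wedge a k"] orth unfolding W by simp
  qed
  ultimately show ?case by (intro exI[of _ p]) (auto simp: fun_eq_iff)
qed

text \<open>
  The squared norm of the product, that is, the Gram determinant of \<open>a 0, \<dots>, a (k - 1)\<close>.
\<close>

definition wedge_norm2 :: "nat set \<Rightarrow> (nat \<Rightarrow> nat \<Rightarrow> real) \<Rightarrow> nat \<Rightarrow> real" where
  "wedge_norm2 I a k = (\<Sum>S\<in>Pow I. (wedge a k S)\<^sup>2)"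

text \<open>
  Lyons' stochastic domination of determinantal measures, with the normalising constants multiplied out.
  Let \<open>u\<close> be the \<open>k\<close>-fold product, \<open>q\<close> the orthogonal component of the
  next vector, and \<open>v\<close> the part of \<open>u\<close> supported on \<open>A\<close>. Then
  \<open>\<parallel>q\<parallel>\<^sup>2 \<langle>v, u\<rangle> = \<langle>q \<and> v, q \<and> u\<rangle>\<close>, the multivector \<open>q \<and> v\<close> lives on the upper
  neighbours of \<open>A\<close> and has norm at most \<open>\<parallel>q\<parallel> \<parallel>v\<parallel>\<close>, so the Cauchy-Schwarz
  inequality on those neighbours gives the claim.
\<close>

lemma wedge_domination:
  assumes I: "finite I" and A: "A \<subseteq> Pow I"
  defines "N \<equiv> {S \<in> Pow I. \<exists>i\<in>S. S - {i} \<in> A}"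
  shows "(\<Sum>T\<in>A. (wedge a k T)\<^sup>2) * wedge_norm2 I a (Suc k) \<le>
    (\<Sum>S\<in>N. (wedge a (Suc k) S)\<^sup>2) * wedge_norm2 I a k"
proof -
  let ?u = "wedge a k"
  obtain q where q: "ext_mul q ?u = wedge a (Suc k)" and q0: "\<And>T. T \<subseteq> I \<Longrightarrow> contract I q ?u T = 0"
    using wedge_orthogonal_component[OF I, of a k "a k"] by auto
  define v where "v T = (if T \<in> A then ?u T else 0)" for T
  define d where "d = dot I q q"
  define X where "X = (\<Sum>T\<in>A. (?u T)\<^sup>2)"
  define Y where "Y = (\<Sum>S\<in>N. (wedge a (Suc k) S)\<^sup>2)"
  have fin: "finite (Pow I)" "finite A" "N \<subseteq> Pow I" "finite N"
    using I A finite_subset[of A "Pow I"] by (auto simp: N_def)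
  have d0: "0 \<le> d" unfolding d_def dot_def by (intro sum_nonneg) auto
  have X0: "0 \<le> X" "0 \<le> Y" unfolding X_def Y_def by (auto intro: sum_nonneg)
  have Z: "wedge_norm2 I a (Suc k) = d * wedge_norm2 I a k"
    using ext_mul_inner_of_contract_0[OF I q0, of ?u] unfolding wedge_norm2_def d_def q
    by (simp add: power2_eq_square)
  have Xv: "X = (\<Sum>T\<in>Pow I. v T * ?u T)" "X = (\<Sum>T\<in>Pow I. (v T)\<^sup>2)"
    unfolding X_def using fin(1) A
    by (intro sum.mono_neutral_cong_left; auto simp: v_def power2_eq_square)+
  have supp: "ext_mul q v S = 0" if "S \<in> Pow I - N" for S
    using that unfolding ext_mul_def N_def by (intro sum.neutral) (auto simp: v_def)
  have "d * X = (\<Sum>S\<in>Pow I. ext_mul q v S * wedge a (Suc k) S)"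
    using ext_mul_inner_of_contract_0[OF I q0, of v] unfolding q Xv(1) d_def by simp
  also have "\<dots> = (\<Sum>S\<in>N. ext_mul q v S * wedge a (Suc k) S)"
    using fin supp by (intro sum.mono_neutral_right) auto
  finally have "(d * X)\<^sup>2 \<le> (\<Sum>S\<in>N. (ext_mul q v S)\<^sup>2) * Y"
    unfolding Y_def using Cauchy_Schwarz_ineq_sum[of "ext_mul q v" "wedge a (Suc k)" N] by simp
  also have "(\<Sum>S\<in>N. (ext_mul q v S)\<^sup>2) \<le> (\<Sum>S\<in>Pow I. (ext_mul q v S)\<^sup>2)"
    using fin by (intro sum_mono2) auto
  also have "\<dots> \<le> d * X" unfolding Xv(2) d_def by (rule ext_mul_norm_le[OF I])
  finally have "(d * X) * (d * X) \<le> (d * X) * Y" using X0 by (simp add: mult_right_mono power2_eq_square)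
  then have "d * X \<le> Y"
    using X0 d0 by (cases "d * X = 0") (auto simp: mult_le_cancel_left)
  then have "d * X * wedge_norm2 I a k \<le> Y * wedge_norm2 I a k"
    by (intro mult_right_mono) (auto simp: wedge_norm2_def sum_nonneg)
  then show ?thesis unfolding Z X_def Y_def by (simp add: algebra_simps)
qed

section \<open>Minors as coordinates of wedge products\<close>

text \<open>
  \<open>pick S\<close> enumerates \<open>S\<close> increasingly; it is the row selection of
  \<open>submatrix\<close>.
\<close>

lemma bij_betw_pick:
  assumes "card S = k" "finite S"
  shows "bij_betw (pick S) {..<k} S" "strict_mono_on {..<k} (pick S)"
proof -
  show sm: "strict_mono_on {..<k} (pick S)"
    using assms pick_mono_le by (intro strict_mono_onI) auto
  have inj: "inj_on (pick S) {..<k}" using sm by (rule strict_mono_on_imp_inj_on)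
  have "pick S ` {..<k} \<subseteq> S" using assms pick_in_set_le by auto
  moreover have "card (pick S ` {..<k}) = card S" using assms inj by (simp add: card_image)
  ultimately show "bij_betw (pick S) {..<k} S"
    using inj assms(2) unfolding bij_betw_def by (metis card_subset_eq)
qed

lemma pick_lessThan:
  assumes "c < k"
  shows "pick {..<k} c = c"
proof -
  have "{a \<in> {..<k}. a < c} = {..<c}" using assms by auto
  then show ?thesis using pick_card_in_set[of c "{..<k}"] assms by simp
qed

text \<open>
  Laplace expansion along the last column is multiplication by the last vector, except that the new
  factor enters at the back instead of the front. This costs a sign \<open>\<epsilon>\<close> that depends on
  \<open>k\<close> only, hence its place before the quantifier over \<open>f\<close>.
\<close>

lemma det_mat_eq_wedge_strict_mono:
  "\<exists>\<epsilon>::real. \<epsilon>\<^sup>2 = 1 \<and> (\<forall>f. strict_mono_on {..<k} f \<longrightarrow>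
     det (mat k k (\<lambda>(r, c). a c (f r))) = \<epsilon> * wedge a k (f ` {..<k}))"
proof (induction k)
  case 0
  show ?case by (intro exI[of _ 1]) (auto simp: det_def)
next
  case (Suc k)
  then obtain \<epsilon> :: real where \<epsilon>: "\<epsilon>\<^sup>2 = 1"
    "\<And>f. strict_mono_on {..<k} f \<Longrightarrow>
       det (mat k k (\<lambda>(r, c). a c (f r))) = \<epsilon> * wedge a k (f ` {..<k})" by blast
  have "det (mat (Suc k) (Suc k) (\<lambda>(r, c). a c (f r))) = ((-1)^k * \<epsilon>) * wedge a (Suc k) (f ` {..<Suc k})"
    if f: "strict_mono_on {..<Suc k} f" for f
  proof -
    let ?M = "mat (Suc k) (Suc k) (\<lambda>(r, c). a c (f r))"
    let ?S = "f ` {..<Suc k}"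
    have inj: "inj_on f {..<Suc k}" using f by (rule strict_mono_on_imp_inj_on)
    have cof: "cofactor ?M i k = (-1)^k * \<epsilon> * (ext_sign (f i) ?S * wedge a k (?S - {f i}))"
      if i: "i < Suc k" for i
    proof -
      define g where "g r = f (if r < i then r else Suc r)" for r
      have "strict_mono_on {..<k} g"
        unfolding g_def by (intro strict_mono_onI strict_mono_onD[OF f]) auto
      then have "det (mat k k (\<lambda>(r, c). a c (g r))) = \<epsilon> * wedge a k (g ` {..<k})" by (rule \<epsilon>(2))
      moreover have "mat_delete ?M i k = mat k k (\<lambda>(r, c). a c (g r))"
        unfolding mat_delete_def by (rule eq_matI) (use i in \<open>auto simp: g_def\<close>)
      moreover have "g ` {..<k} = ?S - {f i}"
      proof -
        have "(\<lambda>r. if r < i then r else Suc r) ` {..<k} = {..<Suc k} - {i}" (is "?h ` _ = _")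
        proof (intro equalityI subsetI)
          fix x assume x: "x \<in> {..<Suc k} - {i}"
          then have "x = ?h (if x < i then x else x - 1)" "(if x < i then x else x - 1) \<in> {..<k}"
            using i by auto
          then show "x \<in> ?h ` {..<k}" by blast
        qed (use i in \<open>auto split: if_splits\<close>)
        then have "g ` {..<k} = f ` ({..<Suc k} - {i})"
          unfolding g_def by (metis image_image)
        also have "\<dots> = ?S - {f i}"
          using inj_on_image_set_diff[OF inj, of "{..<Suc k}" "{i}"] i by auto
        finally show ?thesis .
      qed
      moreover have "ext_sign (f i) ?S = (-1)^i"
      proof -
        have "{t \<in> ?S. t < f i} = f ` {..<i}"
          using strict_mono_on_less[OF f] i by auto
        moreover have "card (f ` {..<i}) = i"
          using inj i by (subst card_image) (auto intro: inj_on_subset)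
        ultimately show ?thesis by (simp add: ext_sign_def)
      qed
      ultimately show ?thesis by (simp add: cofactor_def power_add)
    qed
    have "det ?M = (\<Sum>i<Suc k. ?M $$ (i, k) * cofactor ?M i k)"
      by (rule laplace_expansion_column) auto
    also have "\<dots> = (\<Sum>i<Suc k. (-1)^k * \<epsilon> * (ext_sign (f i) ?S * a k (f i) * wedge a k (?S - {f i})))"
      by (rule sum.cong) (auto simp: cof)
    also have "\<dots> = (-1)^k * \<epsilon> * wedge a (Suc k) ?S"
      by (simp only: wedge.simps ext_mul_def sum.reindex[OF inj] sum_distrib_left o_def)
    finally show ?thesis .
  qed
  then show ?case using \<epsilon>(1)
    by (intro exI[of _ "(-1)^k * \<epsilon>"]) (cases "even k"; auto)
qed

text \<open>
  Rows in any order: sorting them changes the determinant by a sign, which the square removes.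
\<close>

lemma det_mat_square_eq_wedge_square:
  assumes f: "inj_on f {..<k}"
  shows "(det (mat k k (\<lambda>(r, c). a c (f r))))\<^sup>2 = (wedge a k (f ` {..<k}))\<^sup>2"
proof -
  let ?S = "f ` {..<k}"
  have cS: "card ?S = k" "finite ?S" using f by (auto simp: card_image)
  note g = bij_betw_pick[OF cS]
  define \<sigma> where "\<sigma> r = (if r < k then inv_into {..<k} (pick ?S) (f r) else r)" for r
  have bij: "bij_betw (inv_into {..<k} (pick ?S) \<circ> f) {..<k} {..<k}"
    using f g(1) by (intro bij_betw_trans[of f _ ?S] bij_betw_inv_into) (auto simp: bij_betw_def)
  have "bij_betw \<sigma> {..<k} {..<k}"
    using bij by (subst bij_betw_cong[where g = "inv_into {..<k} (pick ?S) \<circ> f"]) (auto simp: \<sigma>_def)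
  then have \<sigma>: "\<sigma> permutes {0..<k}"
    unfolding atLeast0LessThan by (rule bij_imp_permutes) (auto simp: \<sigma>_def)
  have pick_\<sigma>: "pick ?S (\<sigma> r) = f r" if "r < k" for r
    using that g(1) unfolding \<sigma>_def by (auto simp: bij_betw_def f_inv_into_f)
  let ?G = "mat k k (\<lambda>(r, c). a c (pick ?S r))"
  have lt: "\<sigma> r < k" if "r < k" for r using permutes_in_image[OF \<sigma>, of r] that by auto
  have "mat k k (\<lambda>(r, c). a c (f r)) = mat k k (\<lambda>(r, c). ?G $$ (\<sigma> r, c))"
    by (rule eq_matI) (auto simp: pick_\<sigma> lt)
  then have "det (mat k k (\<lambda>(r, c). a c (f r))) = signof \<sigma> * det ?G"
    using det_permute_rows[of ?G k \<sigma>] \<sigma> by simp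
  then have "(det (mat k k (\<lambda>(r, c). a c (f r))))\<^sup>2 = (det ?G)\<^sup>2"
    by (auto simp: power_mult_distrib sign_def)
  also have "\<dots> = (wedge a k ?S)\<^sup>2"
    using det_mat_eq_wedge_strict_mono[of k a] g
    by (auto simp: bij_betw_def power_mult_distrib)
  finally show ?thesis .
qed

lemma det_submatrix_square_eq_wedge_square:
  assumes A: "A \<in> carrier_mat n n" and S: "S \<subseteq> {..<n}" "card S = k"
  shows "(det (submatrix A S {..<k}))\<^sup>2 = (wedge (\<lambda>c r. A $$ (r, c)) k S)\<^sup>2"
proof -
  have fS: "finite S" using S finite_subset by auto
  have kn: "k \<le> n" using card_mono[of "{..<n}" S] S by auto
  have idx: "{i. i < n \<and> i \<in> S} = S" "{i. i < n \<and> i \<in> {..<k}} = {..<k}" using S kn by auto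
  have dims: "dim_row A = n" "dim_col A = n" using A by auto
  have "submatrix A S {..<k} = mat k k (\<lambda>(r, c). A $$ (pick S r, pick {..<k} c))"
    unfolding submatrix_def dims idx S(2) by simp
  also have "\<dots> = mat k k (\<lambda>(r, c). A $$ (pick S r, c))"
    by (rule eq_matI) (simp_all add: pick_lessThan)
  finally show ?thesis
    using det_mat_square_eq_wedge_square[of "pick S" k "\<lambda>c r. A $$ (r, c)"] bij_betw_pick(1)[OF S(2) fS]
    unfolding bij_betw_def by metis
qed

section \<open>Gaussian elimination and bordered minors\<close>

text \<open>
  The entry \<open>(i, j)\<close> of the matrix \<open>b\<close> after \<open>k\<close> steps of Gaussian
  elimination without pivoting, with the eliminated rows and columns turned to zero (a Schur
  complement).
\<close>

fun elim :: "(nat \<Rightarrow> nat \<Rightarrow> real) \<Rightarrow> nat \<Rightarrow> nat \<Rightarrow> nat \<Rightarrow> real" where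
  "elim b 0 i j = b i j"
| "elim b (Suc k) i j = elim b k i j - elim b k i k * elim b k k j / elim b k k k"

lemma elim_eq_0:
  assumes "\<And>l. l < k \<Longrightarrow> elim b l l l \<noteq> 0" "i < k \<or> j < k"
  shows "elim b k i j = 0"
  using assms
proof (induction k arbitrary: i j)
  case (Suc k)
  consider "i < k \<or> j < k" | "i = k" | "j = k" using Suc.prems(2) by linarith
  then show ?case
  proof cases
    case 1
    then have "elim b k i j = 0" "elim b k i k * elim b k k j = 0"
      using Suc.IH Suc.prems(1) by auto
    then show ?thesis by simp
  qed (use Suc.prems(1)[of k] in auto)
qed simp

lemma entry_eq_sum_elim:
  "b i j = (\<Sum>l<k. elim b l i l / elim b l l l * elim b l l j) + elim b k i j"
proof (induction k)
  case (Suc k)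
  have "(\<Sum>l<Suc k. elim b l i l / elim b l l l * elim b l l j) + elim b (Suc k) i j =
      (\<Sum>l<k. elim b l i l / elim b l l l * elim b l l j) + elim b k i j" by simp
  then show ?case using Suc.IH by argo
qed simp

text \<open>
  Bordering the leading \<open>k \<times> k\<close> block with row \<open>i\<close> and column
  \<open>j\<close> gives a matrix whose own factorization is read off from the elimination: all its
  pivots are those of \<open>b\<close>, except the last, which is \<open>elim b k i j\<close>.
\<close>

lemma det_bordered_eq_elim:
  assumes piv: "\<And>l. l < k \<Longrightarrow> elim b l l l \<noteq> 0"
  shows "det (mat (Suc k) (Suc k) (\<lambda>(r, c). b (if r < k then r else i) (if c < k then c else j))) =
    (\<Prod>l<k. elim b l l l) * elim b k i j" (is "det ?M = _")
proof -
  define row where "row r = (if r < k then r else i)" for r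
  define col where "col c = (if c < k then c else j)" for c
  define L where "L = mat (Suc k) (Suc k)
    (\<lambda>(r, l). if l < k then elim b l (row r) l / elim b l l l else if r = k then 1 else 0)"
  define U where "U = mat (Suc k) (Suc k)
    (\<lambda>(l, c). if l < k then elim b l l (col c) else if c = k then elim b k i j else 0)"
  have z: "elim b l x y = 0" if "x < l \<or> y < l" "l \<le> k" for l x y
    using piv that by (intro elim_eq_0) auto
  have LU: "L \<in> carrier_mat (Suc k) (Suc k)" "U \<in> carrier_mat (Suc k) (Suc k)"
    by (auto simp: L_def U_def)
  have "?M = L * U"
  proof (rule eq_matI)
    fix r c assume "r < dim_row (L * U)" "c < dim_col (L * U)"
    then have rc: "r < Suc k" "c < Suc k" using LU by auto
    have "(L * U) $$ (r, c) = (\<Sum>l<Suc k. L $$ (r, l) * U $$ (l, c))"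
      using rc LU by (simp add: scalar_prod_def atLeast0LessThan)
    also have "\<dots> = (\<Sum>l<k. elim b l (row r) l / elim b l l l * elim b l l (col c))
        + (if r = k \<and> c = k then elim b k i j else 0)"
      using rc by (simp add: L_def U_def)
    also have "(if r = k \<and> c = k then elim b k i j else 0) = elim b k (row r) (col c)"
      using rc z by (auto simp: row_def col_def)
    also have "(\<Sum>l<k. elim b l (row r) l / elim b l l l * elim b l l (col c)) + elim b k (row r) (col c)
        = b (row r) (col c)"
      by (rule entry_eq_sum_elim[symmetric])
    finally show "?M $$ (r, c) = (L * U) $$ (r, c)" using rc by (simp add: row_def col_def)
  qed (use LU in auto)
  moreover have "det L = 1"
  proof -
    have "det L = prod_list (diag_mat L)"
      by (rule det_lower_triangular[OF _ LU(1)]) (auto simp: L_def row_def z)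
    also have "\<dots> = (\<Prod>l<Suc k. L $$ (l, l))" using LU by (simp add: prod_list_diag_prod atLeast0LessThan)
    also have "\<dots> = 1" by (rule prod.neutral) (auto simp: L_def row_def piv)
    finally show ?thesis .
  qed
  moreover have "det U = (\<Prod>l<k. elim b l l l) * elim b k i j"
  proof -
    have "det U = prod_list (diag_mat U)"
      by (rule det_upper_triangular[OF _ LU(2)]) (auto simp: U_def col_def z)
    also have "\<dots> = (\<Prod>l<Suc k. U $$ (l, l))" using LU by (simp add: prod_list_diag_prod atLeast0LessThan)
    also have "\<dots> = (\<Prod>l<k. elim b l l l) * elim b k i j" by (simp add: U_def col_def)
    finally show ?thesis .
  qed
  ultimately show ?thesis using det_mult[OF LU] by simp
qed

definition elim_L :: "nat \<Rightarrow> (nat \<Rightarrow> nat \<Rightarrow> real) \<Rightarrow> real mat" where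
  "elim_L n b = mat n n (\<lambda>(i, k). elim b k i k / elim b k k k)"

definition elim_U :: "nat \<Rightarrow> (nat \<Rightarrow> nat \<Rightarrow> real) \<Rightarrow> real mat" where
  "elim_U n b = mat n n (\<lambda>(k, j). elim b k k j)"

lemma is_LU_elim:
  assumes piv: "\<And>l. l < n \<Longrightarrow> elim b l l l \<noteq> 0"
  shows "is_LU (mat n n (\<lambda>(i, j). b i j)) (elim_L n b) (elim_U n b)"
proof -
  have z: "elim b l x y = 0" if "x < l \<or> y < l" "l \<le> n" for l x y
    using piv that by (intro elim_eq_0) auto
  have "mat n n (\<lambda>(i, j). b i j) = elim_L n b * elim_U n b"
  proof (rule eq_matI)
    fix i j assume "i < dim_row (elim_L n b * elim_U n b)" "j < dim_col (elim_L n b * elim_U n b)"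
    then have ij: "i < n" "j < n" by (auto simp: elim_L_def elim_U_def)
    then have "(elim_L n b * elim_U n b) $$ (i, j) = (\<Sum>l<n. elim b l i l / elim b l l l * elim b l l j)"
      by (simp add: elim_L_def elim_U_def scalar_prod_def atLeast0LessThan)
    also have "\<dots> = b i j" using entry_eq_sum_elim[of b i j n] z ij by simp
    finally show "mat n n (\<lambda>(i, j). b i j) $$ (i, j) = (elim_L n b * elim_U n b) $$ (i, j)"
      using ij by simp
  qed (auto simp: elim_L_def elim_U_def)
  then show ?thesis
    unfolding is_LU_def using piv z
    by (auto simp: elim_L_def elim_U_def unit_lower_triangular_def)
qed

text \<open>
  Any factorization peels off one rank-one term per step, so by induction on \<open>k\<close> its remaining
  terms add up to the eliminated matrix, whose first nonzero row and column determine the next factors.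
\<close>

lemma is_LU_unique:
  assumes piv: "\<And>l. l < n \<Longrightarrow> elim b l l l \<noteq> 0"
    and LU: "is_LU (mat n n (\<lambda>(i, j). b i j)) L U"
  shows "L = elim_L n b" "U = elim_U n b"
proof -
  have dims: "L \<in> carrier_mat n n" "U \<in> carrier_mat n n" using LU by (auto simp: is_LU_def)
  have L1: "L $$ (i, i) = 1" if "i < n" for i
    using LU dims that by (auto simp: is_LU_def unit_lower_triangular_def)
  have L0: "L $$ (i, j) = 0" if "i < j" "j < n" for i j
    using LU dims that by (auto simp: is_LU_def unit_lower_triangular_def)
  have U0: "U $$ (i, j) = 0" if "j < i" "i < n" for i j
    using LU dims that by (auto simp: is_LU_def)
  have b: "b i j = (\<Sum>l<n. L $$ (i, l) * U $$ (l, j))" if "i < n" "j < n" for i j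
  proof -
    have "b i j = (L * U) $$ (i, j)" using LU that unfolding is_LU_def by (metis index_mat(1) case_prod_conv)
    then show ?thesis using that dims by (simp add: scalar_prod_def atLeast0LessThan)
  qed
  have inv: "elim b k i j = (\<Sum>l\<in>{k..<n}. L $$ (i, l) * U $$ (l, j))"
    if "k \<le> n" "i < n" "j < n" for k i j
    using that
  proof (induction k arbitrary: i j)
    case 0
    then show ?case using b by (simp add: atLeast0LessThan)
  next
    case (Suc k)
    have split: "elim b k i j = L $$ (i, k) * U $$ (k, j) + (\<Sum>l\<in>{Suc k..<n}. L $$ (i, l) * U $$ (l, j))"
      if "i < n" "j < n" for i j
      using Suc.IH[of i j] Suc.prems that by (simp add: sum.atLeast_Suc_lessThan)
    have r: "elim b k k j = U $$ (k, j)" if "j < n" for j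
      using split[of k j] Suc.prems that L1 L0 by (simp add: sum.neutral)
    have c: "elim b k i k = L $$ (i, k) * U $$ (k, k)"
      using split[of i k] Suc.prems U0 by (simp add: sum.neutral)
    have "U $$ (k, k) \<noteq> 0" using piv[of k] r[of k] Suc.prems by simp
    then show ?case using split[of i j] r[of j] r[of k] c Suc.prems by simp
  qed
  have split: "elim b k i j = L $$ (i, k) * U $$ (k, j) + (\<Sum>l\<in>{Suc k..<n}. L $$ (i, l) * U $$ (l, j))"
    if "i < n" "j < n" "k < n" for i j k
    using inv[of k i j] that by (simp add: sum.atLeast_Suc_lessThan)
  have r: "elim b k k j = U $$ (k, j)" if "j < n" "k < n" for j k
    using split[of k j k] that L1 L0 by (simp add: sum.neutral)
  have c: "elim b k i k = L $$ (i, k) * U $$ (k, k)" if "i < n" "k < n" for i k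
    using split[of i k k] that U0 by (simp add: sum.neutral)
  show "U = elim_U n b"
    using dims by (intro eq_matI) (auto simp: elim_U_def r)
  show "L = elim_L n b"
  proof (rule eq_matI)
    fix i k assume "i < dim_row (elim_L n b)" "k < dim_col (elim_L n b)"
    then have ik: "i < n" "k < n" by (auto simp: elim_L_def)
    then have "U $$ (k, k) \<noteq> 0" using piv[of k] r[of k k] by simp
    then have "L $$ (i, k) = elim b k i k / elim b k k k" using c[OF ik] r[of k k] ik by simp
    then show "L $$ (i, k) = elim_L n b $$ (i, k)" using ik by (simp add: elim_L_def)
  qed (use dims in \<open>auto simp: elim_L_def\<close>)
qed

lemma LU_eq_elim:
  assumes "\<And>l. l < n \<Longrightarrow> elim b l l l \<noteq> 0"
  defines "B \<equiv> mat n n (\<lambda>(i, j). b i j)"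
  shows "has_LU B" "LU_L B = elim_L n b" "LU_U B = elim_U n b"
proof -
  have ex: "is_LU B (elim_L n b) (elim_U n b)"
    unfolding B_def by (rule is_LU_elim) (use assms in auto)
  have uniq: "L = elim_L n b" "U = elim_U n b" if "is_LU B L U" for L U
    using is_LU_unique[OF _ that[unfolded B_def]] assms by auto
  show "has_LU B" using ex by (auto simp: has_LU_def)
  show "LU_L B = elim_L n b" unfolding LU_L_def by (rule the_equality) (use ex uniq in blast)+
  show "LU_U B = elim_U n b" unfolding LU_U_def by (rule the_equality) (use ex uniq in blast)+
qed

lemma wedge_cong: "(\<And>c. c < k \<Longrightarrow> a c = a' c) \<Longrightarrow> wedge a k = wedge a' k"
proof (induction k)
  case (Suc k)
  have "wedge a k = wedge a' k" by (rule Suc.IH) (rule Suc.prems, simp)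
  moreover have "a k = a' k" by (rule Suc.prems) simp
  ultimately show ?case by simp
qed simp

text \<open>
  For the row-permuted matrix, the ratio of the bordered minor to the leading minor becomes a ratio of
  coordinates of multivectors. Up to sign these depend on the permutation only through the set of the
  first \<open>k\<close> chosen rows and the additional row.
\<close>

lemma elim_square_eq_wedge:
  assumes \<pi>: "inj_on \<pi> {..<n}"
    and nz: "\<And>l. l \<le> n \<Longrightarrow> wedge a l (\<pi> ` {..<l}) \<noteq> 0"
  defines "b \<equiv> \<lambda>i j. a j (\<pi> i)"
  shows "k < n \<Longrightarrow> elim b k k k \<noteq> 0"
    and "\<lbrakk>k \<le> i; i < n\<rbrakk> \<Longrightarrow> (elim b k i j)\<^sup>2 =
      (ext_mul (a j) (wedge a k) (insert (\<pi> i) (\<pi> ` {..<k})))\<^sup>2 / (wedge a k (\<pi> ` {..<k}))\<^sup>2"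
proof -
  have bordered: "((\<Prod>l<k. elim b l l l) * elim b k i j)\<^sup>2 =
      (ext_mul (a j) (wedge a k) (insert (\<pi> i) (\<pi> ` {..<k})))\<^sup>2"
    if piv: "\<And>l. l < k \<Longrightarrow> elim b l l l \<noteq> 0" and i: "k \<le> i" "i < n" for k i j
  proof -
    define f where "f r = \<pi> (if r < k then r else i)" for r
    define a' where "a' c = a (if c < k then c else j)" for c
    have "inj_on f {..<Suc k}"
    proof (rule inj_onI)
      fix r s assume rs: "r \<in> {..<Suc k}" "s \<in> {..<Suc k}" "f r = f s"
      then have "(if r < k then r else i) = (if s < k then s else i)"
        using i unfolding f_def by (intro inj_onD[OF \<pi> rs(3)[unfolded f_def]]) auto
      then show "r = s" using rs i by (auto split: if_splits)
    qed
    from det_mat_square_eq_wedge_square[OF this, of a']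
    have "((\<Prod>l<k. elim b l l l) * elim b k i j)\<^sup>2 = (wedge a' (Suc k) (f ` {..<Suc k}))\<^sup>2"
      using det_bordered_eq_elim[OF piv, of k i j] unfolding b_def f_def a'_def by simp
    also have "wedge a' (Suc k) = ext_mul (a j) (wedge a k)"
      using wedge_cong[of k a' a] by (simp add: a'_def)
    also have "f ` {..<Suc k} = insert (f k) (f ` {..<k})" by (simp only: lessThan_Suc image_insert)
    also have "f ` {..<k} = \<pi> ` {..<k}" by (rule image_cong) (simp_all add: f_def)
    also have "f k = \<pi> i" by (simp add: f_def)
    finally show ?thesis .
  qed
  have leading: "(\<Prod>l<Suc k. elim b l l l)\<^sup>2 = (wedge a (Suc k) (\<pi> ` {..<Suc k}))\<^sup>2"
    if "\<And>l. l < k \<Longrightarrow> elim b l l l \<noteq> 0" "k < n" for k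
  proof -
    have prefix: "insert (\<pi> k) (\<pi> ` {..<k}) = \<pi> ` {..<Suc k}" by (simp add: lessThan_Suc)
    have "((\<Prod>l<k. elim b l l l) * elim b k k k)\<^sup>2 = (wedge a (Suc k) (\<pi> ` {..<Suc k}))\<^sup>2"
      using bordered[OF that(1) order_refl that(2), of k] unfolding wedge.simps prefix by simp
    then show ?thesis by (simp only: prod.lessThan_Suc)
  qed
  have piv: "elim b k k k \<noteq> 0" if "k < n" for k
    using that
  proof (induction k rule: less_induct)
    case (less k)
    have pivk: "elim b l l l \<noteq> 0" if "l < k" for l
      by (rule less.IH[OF that order_less_trans[OF that less.prems]])
    have nzk: "wedge a (Suc k) (\<pi> ` {..<Suc k}) \<noteq> 0" using nz less.prems by (simp add: Suc_leI del: wedge.simps)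
    have eq: "(\<Prod>l<Suc k. elim b l l l)\<^sup>2 = (wedge a (Suc k) (\<pi> ` {..<Suc k}))\<^sup>2"
      by (rule leading) (use pivk less.prems in auto)
    have "(\<Prod>l<Suc k. elim b l l l)\<^sup>2 \<noteq> 0"
      unfolding eq using nzk by (simp del: wedge.simps)
    then show ?case by simp
  qed
  then show "k < n \<Longrightarrow> elim b k k k \<noteq> 0" .
  show "(elim b k i j)\<^sup>2 = (ext_mul (a j) (wedge a k) (insert (\<pi> i) (\<pi> ` {..<k})))\<^sup>2 / (wedge a k (\<pi> ` {..<k}))\<^sup>2"
    if i: "k \<le> i" "i < n"
  proof -
    have pivk: "elim b l l l \<noteq> 0" if "l < k" for l using that i by (intro piv) auto
    have "(\<Prod>l<k. elim b l l l)\<^sup>2 = (wedge a k (\<pi> ` {..<k}))\<^sup>2"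
    proof (cases k)
      case (Suc m)
      show ?thesis unfolding Suc by (rule leading) (use pivk i Suc in auto)
    qed simp
    then have "(wedge a k (\<pi> ` {..<k}))\<^sup>2 * (elim b k i j)\<^sup>2 =
        (ext_mul (a j) (wedge a k) (insert (\<pi> i) (\<pi> ` {..<k})))\<^sup>2"
      using bordered[OF pivk i, of j] by (simp add: power_mult_distrib)
    moreover have "(wedge a k (\<pi> ` {..<k}))\<^sup>2 \<noteq> 0" using nz[of k] i by simp
    ultimately show ?thesis by (metis nonzero_mult_div_cancel_left)
  qed
qed

section \<open>Nested volume sampling\<close>

lemma wedge_eq_0: "wedge a k S = 0" if "\<not> (finite S \<and> card S = k)"
  using that
proof (induction k arbitrary: S)
  case (Suc k)
  show ?case
  proof (cases "finite S")
    case True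
    have "wedge a k (S - {i}) = 0" if "i \<in> S" for i
      using Suc.prems True card.remove[OF True that] by (intro Suc.IH) auto
    then show ?thesis by (simp add: ext_mul_def)
  qed (simp add: ext_mul_def)
qed auto

lemma wedge_norm2_nonneg: "0 \<le> wedge_norm2 I a k"
  by (simp add: wedge_norm2_def sum_nonneg)

lemma wedge_norm2_pos:
  assumes I: "finite I" and top: "wedge a n I \<noteq> 0" and "k \<le> n"
  shows "0 < wedge_norm2 I a k"
  using \<open>k \<le> n\<close>
proof (induction k rule: inc_induct)
  case base
  have "(wedge a n I)\<^sup>2 \<le> wedge_norm2 I a n"
    unfolding wedge_norm2_def using I by (intro member_le_sum) auto
  moreover have "0 < (wedge a n I)\<^sup>2" using top by simp
  ultimately show ?case by linarith
next
  case (step k)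
  have "wedge_norm2 I a (Suc k) \<le> dot I (a k) (a k) * wedge_norm2 I a k"
    unfolding wedge_norm2_def wedge.simps by (rule ext_mul_norm_le[OF I])
  then have "wedge_norm2 I a k \<noteq> 0" using step by auto
  then show ?case using wedge_norm2_nonneg[of I a k] by linarith
qed

text \<open>
  The determinantal distribution of the first \<open>k\<close> columns on sets of \<open>k\<close> rows.
\<close>

definition volume_pmf :: "nat set \<Rightarrow> (nat \<Rightarrow> nat \<Rightarrow> real) \<Rightarrow> nat \<Rightarrow> nat set pmf" where
  "volume_pmf I a k = embed_pmf (\<lambda>S. if S \<subseteq> I then (wedge a k S)\<^sup>2 / wedge_norm2 I a k else 0)"

lemma pmf_volume_pmf:
  assumes I: "finite I" and Z: "0 < wedge_norm2 I a k"
  shows "pmf (volume_pmf I a k) S = (if S \<subseteq> I then (wedge a k S)\<^sup>2 / wedge_norm2 I a k else 0)"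
  unfolding volume_pmf_def
proof (rule pmf_embed_pmf)
  let ?f = "\<lambda>S. if S \<subseteq> I then (wedge a k S)\<^sup>2 / wedge_norm2 I a k else 0"
  show "0 \<le> ?f S" for S using Z by simp
  have "(\<integral>\<^sup>+S. ennreal (?f S) \<partial>count_space UNIV) = (\<Sum>S\<in>Pow I. ennreal (?f S))"
    using I by (intro nn_integral_count_space') auto
  also have "\<dots> = ennreal (\<Sum>S\<in>Pow I. ?f S)" using Z by (intro sum_ennreal) auto
  also have "(\<Sum>S\<in>Pow I. ?f S) = 1"
    using Z by (simp add: wedge_norm2_def flip: sum_divide_distrib)
  finally show "(\<integral>\<^sup>+S. ennreal (?f S) \<partial>count_space UNIV) = 1" by simp
qed

lemma set_volume_pmf:
  assumes "finite I" "0 < wedge_norm2 I a k"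
  shows "set_pmf (volume_pmf I a k) = {S \<in> Pow I. wedge a k S \<noteq> 0}"
  using assms by (auto simp: set_pmf_eq pmf_volume_pmf)

lemma measure_volume_pmf:
  assumes "finite I" "0 < wedge_norm2 I a k" "A \<subseteq> Pow I"
  shows "measure (volume_pmf I a k) A = (\<Sum>S\<in>A. (wedge a k S)\<^sup>2) / wedge_norm2 I a k"
proof -
  have "finite A" using assms finite_subset by (metis finite_Pow_iff)
  moreover have "(\<Sum>S\<in>A. pmf (volume_pmf I a k) S) = (\<Sum>S\<in>A. (wedge a k S)\<^sup>2 / wedge_norm2 I a k)"
    using assms by (intro sum.cong) (auto simp: pmf_volume_pmf)
  ultimately show ?thesis
    by (simp add: measure_measure_pmf_finite sum_divide_distrib)
qed

lemma volume_pmf_coupling: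
  assumes I: "finite I" and Z: "0 < wedge_norm2 I a k" "0 < wedge_norm2 I a (Suc k)"
  shows "rel_pmf (\<lambda>T S. \<exists>i\<in>I - T. S = insert i T) (volume_pmf I a k) (volume_pmf I a (Suc k))"
proof (rule rel_pmf_if_measure_le)
  show "finite (set_pmf (volume_pmf I a k))" "finite (set_pmf (volume_pmf I a (Suc k)))"
    using I by (simp_all add: set_volume_pmf Z del: wedge.simps)
  fix A assume "A \<subseteq> set_pmf (volume_pmf I a k)"
  then have A: "A \<subseteq> Pow I" using I Z by (auto simp: set_volume_pmf)
  define N where "N = {S \<in> Pow I. \<exists>i\<in>S. S - {i} \<in> A}"
  have N: "N \<subseteq> Pow I" "N \<subseteq> {S. \<exists>T\<in>A. \<exists>i\<in>I - T. S = insert i T}"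
  proof -
    show "N \<subseteq> {S. \<exists>T\<in>A. \<exists>i\<in>I - T. S = insert i T}"
    proof
      fix S assume "S \<in> N"
      then obtain i where i: "S \<subseteq> I" "i \<in> S" "S - {i} \<in> A" by (auto simp: N_def)
      then have "i \<in> I - (S - {i})" "S = insert i (S - {i})" by auto
      then show "S \<in> {S. \<exists>T\<in>A. \<exists>i\<in>I - T. S = insert i T}" using i(3) by blast
    qed
  qed (auto simp: N_def)
  have "measure (volume_pmf I a k) A \<le> measure (volume_pmf I a (Suc k)) N"
    using wedge_domination[OF I A, of a k, folded N_def] Z
    unfolding measure_volume_pmf[OF I Z(1) A] measure_volume_pmf[OF I Z(2) N(1)]
    by (simp add: field_simps del: wedge.simps)
  also have "\<dots> \<le> measure (volume_pmf I a (Suc k)) {S. \<exists>T\<in>A. \<exists>i\<in>I - T. S = insert i T}"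
    using N(2) by (intro measure_pmf.finite_measure_mono) auto
  finally show "measure (volume_pmf I a k) A \<le>
      measure (volume_pmf I a (Suc k)) {S. \<exists>T\<in>A. \<exists>i\<in>I - T. S = insert i T}" .
qed

text \<open>
  The couplings of consecutive levels are glued one after another: the coupling of level
  \<open>k\<close> with level \<open>k + 1\<close> is lifted along \<open>\<pi> \<mapsto> \<pi> ` {..<k}\<close> to a coupling with
  the whole history \<open>\<pi>\<close>, which is then extended by the one new element. The identity
  outside \<open>{..<k}\<close> makes the final function a permutation in the sense of
  \<open>permutes\<close>.
\<close>

lemma nested_volume_sampling_exists:
  assumes I: "finite I" and Z: "\<And>j. j \<le> k \<Longrightarrow> 0 < wedge_norm2 I a j"
  shows "\<exists>V. (\<forall>\<pi>\<in>set_pmf V. inj_on \<pi> {..<k} \<and> \<pi> ` {..<k} \<subseteq> I \<and> (\<forall>i\<ge>k. \<pi> i = i)) \<and>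
    (\<forall>j\<le>k. map_pmf (\<lambda>\<pi>. \<pi> ` {..<j}) V = volume_pmf I a j)"
  using Z
proof (induction k)
  case 0
  have "wedge_norm2 I a 0 = (\<Sum>S\<in>{{}}. (wedge a 0 S)\<^sup>2)"
    unfolding wedge_norm2_def using I by (intro sum.mono_neutral_right) auto
  then have "wedge_norm2 I a 0 = 1" by simp
  then have "volume_pmf I a 0 = return_pmf {}"
    using I by (intro pmf_eqI) (auto simp: pmf_volume_pmf pmf_return)
  then show ?case by (intro exI[of _ "return_pmf id"]) simp
next
  case (Suc k)
  then obtain V where V: "\<And>\<pi>. \<pi> \<in> set_pmf V \<Longrightarrow> inj_on \<pi> {..<k} \<and> \<pi> ` {..<k} \<subseteq> I \<and> (\<forall>i\<ge>k. \<pi> i = i)"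
    and marg: "\<And>j. j \<le> k \<Longrightarrow> map_pmf (\<lambda>\<pi>. \<pi> ` {..<j}) V = volume_pmf I a j"
    by (metis le_SucI)
  let ?R = "\<lambda>T S. \<exists>i\<in>I - T. S = insert i T"
  have "rel_pmf ?R (map_pmf (\<lambda>\<pi>. \<pi> ` {..<k}) V) (volume_pmf I a (Suc k))"
    unfolding marg[OF order_refl] using Suc.prems by (intro volume_pmf_coupling I) auto
  then have "rel_pmf (\<lambda>\<pi> S. ?R (\<pi> ` {..<k}) S) V (volume_pmf I a (Suc k))"
    by (simp add: pmf.rel_map)
  then obtain J where J: "\<And>\<pi> S. (\<pi>, S) \<in> set_pmf J \<Longrightarrow> ?R (\<pi> ` {..<k}) S"
    and fst_J: "map_pmf fst J = V" and snd_J: "map_pmf snd J = volume_pmf I a (Suc k)"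
    by (auto elim!: rel_pmf.cases)
  define extend :: "(nat \<Rightarrow> nat) \<times> nat set \<Rightarrow> nat \<Rightarrow> nat" where "extend = (\<lambda>(\<pi>, S). \<pi>(k := the_elem (S - \<pi> ` {..<k})))"
  have extend: "\<exists>i\<in>I - \<pi> ` {..<k}. S = insert i (\<pi> ` {..<k}) \<and> extend (\<pi>, S) = \<pi>(k := i)"
    if in_J: "(\<pi>, S) \<in> set_pmf J" for \<pi> S
  proof -
    obtain i where i: "i \<in> I - \<pi> ` {..<k}" "S = insert i (\<pi> ` {..<k})" using J[OF in_J] by blast
    then have "S - \<pi> ` {..<k} = {i}" by auto
    then have "extend (\<pi>, S) = \<pi>(k := i)" by (simp add: extend_def)
    then show ?thesis using i by blast
  qed
  have in_V: "\<pi> \<in> set_pmf V" if "(\<pi>, S) \<in> set_pmf J" for \<pi> S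
    using that fst_J by (metis fst_conv imageI set_map_pmf)
  let ?V' = "map_pmf extend J"
  have "inj_on \<rho> {..<Suc k} \<and> \<rho> ` {..<Suc k} \<subseteq> I \<and> (\<forall>i\<ge>Suc k. \<rho> i = i)"
    if \<rho>: "\<rho> \<in> set_pmf ?V'" for \<rho>
  proof -
    obtain \<pi> S where \<pi>S: "(\<pi>, S) \<in> set_pmf J" "\<rho> = extend (\<pi>, S)" using \<rho> by auto
    obtain i where i: "i \<in> I - \<pi> ` {..<k}" "\<rho> = \<pi>(k := i)" using extend[OF \<pi>S(1)] \<pi>S(2) by auto
    note \<pi> = V[OF in_V[OF \<pi>S(1)]]
    have im: "\<rho> ` {..<k} = \<pi> ` {..<k}" unfolding i(2) by (intro image_cong) auto
    have "inj_on \<rho> {..<k}" using \<pi> i(2) by (subst inj_on_cong[where g = \<pi>]) auto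
    then have "inj_on \<rho> {..<Suc k}" using i im by (auto simp: lessThan_Suc)
    moreover have "\<rho> ` {..<Suc k} \<subseteq> I" using \<pi> i im by (auto simp: lessThan_Suc)
    moreover have "\<forall>i\<ge>Suc k. \<rho> i = i" using \<pi> i by auto
    ultimately show ?thesis by blast
  qed
  moreover have "map_pmf (\<lambda>\<pi>. \<pi> ` {..<j}) ?V' = volume_pmf I a j" if "j \<le> Suc k" for j
  proof (cases "j = Suc k")
    case True
    have "map_pmf (\<lambda>\<pi>. \<pi> ` {..<Suc k}) ?V' = map_pmf snd J"
      unfolding pmf.map_comp
    proof (rule pmf.map_cong[OF refl])
      fix z assume z: "z \<in> set_pmf J"
      obtain \<pi> S where zz: "z = (\<pi>, S)" by (cases z)
      obtain i where i: "S = insert i (\<pi> ` {..<k})" "extend (\<pi>, S) = \<pi>(k := i)"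
        using extend z zz by blast
      have "\<pi>(k := i) ` {..<k} = \<pi> ` {..<k}" by (intro image_cong) auto
      then show "((\<lambda>\<pi>. \<pi> ` {..<Suc k}) \<circ> extend) z = snd z"
        unfolding zz using i by (simp add: lessThan_Suc)
    qed
    then show ?thesis using True snd_J by simp
  next
    case False
    then have jk: "j \<le> k" using that by simp
    have "map_pmf (\<lambda>\<pi>. \<pi> ` {..<j}) ?V' = map_pmf (\<lambda>\<pi>. \<pi> ` {..<j}) (map_pmf fst J)"
      unfolding pmf.map_comp
    proof (rule pmf.map_cong[OF refl])
      fix z assume "z \<in> set_pmf J"
      show "((\<lambda>\<pi>. \<pi> ` {..<j}) \<circ> extend) z = ((\<lambda>\<pi>. \<pi> ` {..<j}) \<circ> fst) z"
        using jk by (cases z) (auto simp: extend_def intro!: image_cong)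
    qed
    then show ?thesis unfolding fst_J using marg[OF jk] by simp
  qed
  ultimately show ?case by blast
qed

lemma volume_sampling_permutation_exists:
  assumes top: "wedge a n {..<n} \<noteq> 0"
  shows "\<exists>V. set_pmf V \<subseteq> {\<pi>. \<pi> permutes {..<n}} \<and>
    (\<forall>k\<le>n. map_pmf (\<lambda>\<pi>. \<pi> ` {..<k}) V = volume_pmf {..<n} a k)"
proof -
  have Z: "0 < wedge_norm2 {..<n} a j" if "j \<le> n" for j
    using top that by (intro wedge_norm2_pos[of _ a n]) auto
  obtain V where V: "\<forall>\<pi>\<in>set_pmf V. inj_on \<pi> {..<n} \<and> \<pi> ` {..<n} \<subseteq> {..<n} \<and> (\<forall>i\<ge>n. \<pi> i = i)"
    and marg: "\<forall>k\<le>n. map_pmf (\<lambda>\<pi>. \<pi> ` {..<k}) V = volume_pmf {..<n} a k"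
    using nested_volume_sampling_exists[of "{..<n}" n a] Z by blast
  have "\<pi> permutes {..<n}" if "\<pi> \<in> set_pmf V" for \<pi>
  proof (rule bij_imp_permutes)
    have "\<pi> ` {..<n} = {..<n}"
      using V that by (intro endo_inj_surj) auto
    then show "bij_betw \<pi> {..<n} {..<n}" using V that by (simp add: bij_betw_def)
  qed (use V that in auto)
  then show ?thesis using marg by blast
qed

section \<open>Expected size of the triangular factors\<close>

text \<open>
  Exchanging an element of \<open>S\<close> for one outside it is an involution on triples, and every set is
  reached once for each choice of the exchanged pair.
\<close>

lemma sum_exchange_Pow:
  fixes F :: "nat set \<Rightarrow> real"
  assumes I: "finite I"
  shows "(\<Sum>S\<in>Pow I. \<Sum>t\<in>S. \<Sum>x\<in>I - S. F (insert x (S - {t}))) =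
    (\<Sum>S\<in>Pow I. real (card S) * real (card (I - S)) * F S)"
proof -
  have fS: "finite S" if "S \<in> Pow I" for S using that I finite_subset by auto
  have "(\<Sum>S\<in>Pow I. \<Sum>t\<in>S. \<Sum>x\<in>I - S. F (insert x (S - {t}))) =
      (\<Sum>S\<in>Pow I. \<Sum>(t, x)\<in>S \<times> (I - S). F (insert x (S - {t})))"
    by (simp add: sum.cartesian_product)
  also have "\<dots> = (\<Sum>(S, t, x)\<in>Sigma (Pow I) (\<lambda>S. S \<times> (I - S)). F (insert x (S - {t})))"
    using I fS by (subst sum.Sigma) auto
  also have "\<dots> = (\<Sum>(S, x, t)\<in>Sigma (Pow I) (\<lambda>S. S \<times> (I - S)). F S)"
    by (rule sum.reindex_bij_witness[where
          i = "\<lambda>(S, x, t). (insert t (S - {x}), t, x)" and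
          j = "\<lambda>(S, t, x). (insert x (S - {t}), x, t)"]) (auto simp: insert_absorb)
  also have "\<dots> = (\<Sum>S\<in>Pow I. \<Sum>(t, x)\<in>S \<times> (I - S). F S)"
    using I fS by (subst sum.Sigma) auto
  also have "\<dots> = (\<Sum>S\<in>Pow I. real (card S) * real (card (I - S)) * F S)"
    by (simp add: card_cartesian_product case_prod_unfold)
  finally show ?thesis .
qed

text \<open>
  All that the estimates use of the random permutation is the law of each of its prefix sets.
\<close>

locale volume_sampling =
  fixes n :: nat and a :: "nat \<Rightarrow> nat \<Rightarrow> real" and V :: "(nat \<Rightarrow> nat) pmf"
  assumes nonsingular: "wedge a n {..<n} \<noteq> 0"
    and permutes: "set_pmf V \<subseteq> {\<pi>. \<pi> permutes {..<n}}"
    and marginal: "k \<le> n \<Longrightarrow> map_pmf (\<lambda>\<pi>. \<pi> ` {..<k}) V = volume_pmf {..<n} a k"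
begin

abbreviation "pivoted \<pi> \<equiv> (\<lambda>i j. a j (\<pi> i))"

lemma finite_support: "finite (set_pmf V)"
  using permutes finite_permutations[of "{..<n}"] by (auto intro: finite_subset)

lemma norm_pos: "k \<le> n \<Longrightarrow> 0 < wedge_norm2 {..<n} a k"
  using nonsingular by (intro wedge_norm2_pos[of _ a n]) auto

lemma prefix_nonzero:
  assumes "\<pi> \<in> set_pmf V" "k \<le> n"
  shows "wedge a k (\<pi> ` {..<k}) \<noteq> 0"
proof -
  have "\<pi> ` {..<k} \<in> set_pmf (map_pmf (\<lambda>\<pi>. \<pi> ` {..<k}) V)" using assms by auto
  then show ?thesis
    unfolding marginal[OF assms(2)] set_volume_pmf[OF finite_lessThan norm_pos[OF assms(2)]] by simp
qed

lemma expectation_prefix: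
  assumes k: "k \<le> n"
  shows "measure_pmf.expectation V (\<lambda>\<pi>. g (\<pi> ` {..<k})) =
    (\<Sum>S\<in>Pow {..<n}. g S * (wedge a k S)\<^sup>2) / wedge_norm2 {..<n} a k"
proof -
  have "measure_pmf.expectation V (\<lambda>\<pi>. g (\<pi> ` {..<k})) =
      measure_pmf.expectation (map_pmf (\<lambda>\<pi>. \<pi> ` {..<k}) V) g" by simp
  also have "\<dots> = (\<Sum>S\<in>Pow {..<n}. g S * pmf (volume_pmf {..<n} a k) S)"
    unfolding marginal[OF k]
    using set_volume_pmf[OF finite_lessThan norm_pos[OF k]]
    by (intro integral_measure_pmf_real) auto
  also have "\<dots> = (\<Sum>S\<in>Pow {..<n}. g S * (wedge a k S)\<^sup>2) / wedge_norm2 {..<n} a k"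
    unfolding sum_divide_distrib
    by (intro sum.cong) (auto simp: pmf_volume_pmf[OF finite_lessThan norm_pos[OF k]])
  finally show ?thesis .
qed

lemma expectation_mono:
  fixes f g :: "(nat \<Rightarrow> nat) \<Rightarrow> real"
  assumes "\<And>\<pi>. \<pi> \<in> set_pmf V \<Longrightarrow> f \<pi> \<le> g \<pi>"
  shows "measure_pmf.expectation V f \<le> measure_pmf.expectation V g"
  using assms integrable_measure_pmf_finite[OF finite_support]
  by (intro integral_mono_AE) (auto simp: AE_measure_pmf_iff)

lemma expectation_sum:
  fixes f :: "'b \<Rightarrow> (nat \<Rightarrow> nat) \<Rightarrow> real"
  shows "measure_pmf.expectation V (\<lambda>\<pi>. \<Sum>x\<in>X. f x \<pi>) = (\<Sum>x\<in>X. measure_pmf.expectation V (f x))"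
  by (rule Bochner_Integration.integral_sum) (rule integrable_measure_pmf_finite[OF finite_support])

lemma
  assumes "\<pi> \<in> set_pmf V"
  shows pivot_nonzero: "k < n \<Longrightarrow> elim (pivoted \<pi>) k k k \<noteq> 0"
    and elim_square: "\<lbrakk>k \<le> i; i < n\<rbrakk> \<Longrightarrow> (elim (pivoted \<pi>) k i j)\<^sup>2 =
      (ext_mul (a j) (wedge a k) (insert (\<pi> i) (\<pi> ` {..<k})))\<^sup>2 / (wedge a k (\<pi> ` {..<k}))\<^sup>2"
proof -
  have inj: "inj_on \<pi> {..<n}" using permutes assms permutes_inj_on by blast
  note nz = prefix_nonzero[OF assms]
  show "k < n \<Longrightarrow> elim (pivoted \<pi>) k k k \<noteq> 0" by (rule elim_square_eq_wedge(1)[OF inj nz])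
  show "\<lbrakk>k \<le> i; i < n\<rbrakk> \<Longrightarrow> (elim (pivoted \<pi>) k i j)\<^sup>2 =
      (ext_mul (a j) (wedge a k) (insert (\<pi> i) (\<pi> ` {..<k})))\<^sup>2 / (wedge a k (\<pi> ` {..<k}))\<^sup>2"
    by (rule elim_square_eq_wedge(2)[OF inj nz])
qed

text \<open>
  The squared entries of column \<open>k\<close> of the lower factor are ratios of the weights of the sets
  \<open>S - {\<pi> k} \<union> {x}\<close> and \<open>S = \<pi> ` {..k}\<close>. Summing over all \<open>t \<in> S\<close> instead of
  \<open>t = \<pi> k\<close> alone only increases the value and leaves a function of \<open>S\<close>. In its
  expectation the denominators cancel against the law of \<open>S\<close>, and each set is counted once
  for every pair to be exchanged.
\<close>

lemma expectation_L_column: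
  assumes k: "k < n"
  shows "measure_pmf.expectation V (\<lambda>\<pi>. \<Sum>i\<in>{Suc k..<n}. (elim (pivoted \<pi>) k i k / elim (pivoted \<pi>) k k k)\<^sup>2)
    \<le> real (Suc k) * real (n - Suc k)"
proof -
  let ?I = "{..<n}"
  let ?w = "\<lambda>S. (wedge a (Suc k) S)\<^sup>2"
  define g where "g S = (\<Sum>t\<in>S. \<Sum>x\<in>?I - S. ?w (insert x (S - {t})) / ?w S)" for S
  have "(\<Sum>i\<in>{Suc k..<n}. (elim (pivoted \<pi>) k i k / elim (pivoted \<pi>) k k k)\<^sup>2) \<le> g (\<pi> ` {..<Suc k})"
    if \<pi>: "\<pi> \<in> set_pmf V" for \<pi>
  proof -
    let ?S = "\<pi> ` {..<Suc k}"
    have perm: "\<pi> permutes ?I" using permutes \<pi> by auto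
    have inj: "inj \<pi>" using perm by (rule permutes_inj)
    have S: "?S - {\<pi> k} = \<pi> ` {..<k}" "insert (\<pi> k) (\<pi> ` {..<k}) = ?S"
      using inj by (auto simp: lessThan_Suc inj_eq)
    have im: "\<pi> ` {Suc k..<n} = ?I - ?S"
    proof -
      have "{Suc k..<n} = ?I - {..<Suc k}" by auto
      then show ?thesis using image_set_diff[OF inj, of ?I "{..<Suc k}"] permutes_image[OF perm] by simp
    qed
    have nz: "(wedge a k (\<pi> ` {..<k}))\<^sup>2 \<noteq> 0" using prefix_nonzero[OF \<pi>, of k] k by simp
    have "(elim (pivoted \<pi>) k i k / elim (pivoted \<pi>) k k k)\<^sup>2 = ?w (insert (\<pi> i) (?S - {\<pi> k})) / ?w ?S"
      if i: "i \<in> {Suc k..<n}" for i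
      using elim_square[OF \<pi>, of k i k] elim_square[OF \<pi>, of k k k] i k nz
      by (simp add: power_divide S)
    then have "(\<Sum>i\<in>{Suc k..<n}. (elim (pivoted \<pi>) k i k / elim (pivoted \<pi>) k k k)\<^sup>2) =
        (\<Sum>i\<in>{Suc k..<n}. ?w (insert (\<pi> i) (?S - {\<pi> k})) / ?w ?S)"
      by (rule sum.cong[OF refl])
    also have "\<dots> = (\<Sum>x\<in>\<pi> ` {Suc k..<n}. ?w (insert x (?S - {\<pi> k})) / ?w ?S)"
      using inj by (subst sum.reindex) (auto intro: inj_on_subset)
    also have "\<dots> \<le> g ?S"
      unfolding im g_def
      by (rule member_le_sum[where f = "\<lambda>t. \<Sum>x\<in>?I - ?S. ?w (insert x (?S - {t})) / ?w ?S"])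
        (auto intro: sum_nonneg)
    finally show ?thesis .
  qed
  then have "measure_pmf.expectation V (\<lambda>\<pi>. \<Sum>i\<in>{Suc k..<n}. (elim (pivoted \<pi>) k i k / elim (pivoted \<pi>) k k k)\<^sup>2)
      \<le> measure_pmf.expectation V (\<lambda>\<pi>. g (\<pi> ` {..<Suc k}))" by (rule expectation_mono)
  also have "\<dots> = (\<Sum>S\<in>Pow ?I. g S * ?w S) / wedge_norm2 ?I a (Suc k)"
    using k by (intro expectation_prefix) simp
  also have "\<dots> \<le> (real (Suc k) * real (n - Suc k) * wedge_norm2 ?I a (Suc k)) / wedge_norm2 ?I a (Suc k)"
  proof (rule divide_right_mono)
    have "(\<Sum>S\<in>Pow ?I. g S * ?w S) \<le> (\<Sum>S\<in>Pow ?I. \<Sum>t\<in>S. \<Sum>x\<in>?I - S. ?w (insert x (S - {t})))"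
    proof (rule sum_mono)
      fix S assume "S \<in> Pow ?I"
      show "g S * ?w S \<le> (\<Sum>t\<in>S. \<Sum>x\<in>?I - S. ?w (insert x (S - {t})))"
        unfolding g_def sum_distrib_right
        by (intro sum_mono) (simp del: wedge.simps)
    qed
    also have "\<dots> = (\<Sum>S\<in>Pow ?I. real (card S) * real (card (?I - S)) * ?w S)"
      by (rule sum_exchange_Pow) simp
    also have "\<dots> = (\<Sum>S\<in>Pow ?I. real (Suc k) * real (n - Suc k) * ?w S)"
    proof (rule sum.cong[OF refl])
      fix S assume S: "S \<in> Pow ?I"
      show "real (card S) * real (card (?I - S)) * ?w S = real (Suc k) * real (n - Suc k) * ?w S"
      proof (cases "card S = Suc k")
        case True
        then have "card (?I - S) = n - Suc k" using S by (subst card_Diff_subset) (auto intro: finite_subset)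
        then show ?thesis using True by simp
      next
        case False
        then have "wedge a (Suc k) S = 0" by (intro wedge_eq_0) simp
        then show ?thesis by (simp del: wedge.simps)
      qed
    qed
    also have "\<dots> = real (Suc k) * real (n - Suc k) * wedge_norm2 ?I a (Suc k)"
      unfolding wedge_norm2_def by (simp only: sum_distrib_left)
    finally show "(\<Sum>S\<in>Pow ?I. g S * ?w S) \<le> real (Suc k) * real (n - Suc k) * wedge_norm2 ?I a (Suc k)" .
  qed (rule wedge_norm2_nonneg)
  also have "\<dots> = real (Suc k) * real (n - Suc k)" using norm_pos[of "Suc k"] k by (simp del: wedge.simps)
  finally show ?thesis .
qed

text \<open>
  Here the denominator is the weight of the set \<open>T\<close> before step \<open>k\<close>. Summing over
  all possible new rows \<open>x\<close> instead of \<open>\<pi> k\<close> alone leaves a function of \<open>T\<close>,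
  and its expectation counts each coordinate of \<open>a j \<and> wedge a k\<close> once per element of its
  index set; the norm of this product is at most \<open>\<parallel>a j\<parallel>\<close> times that of
  \<open>wedge a k\<close>.
\<close>

lemma expectation_U_entry:
  assumes k: "k < n"
  shows "measure_pmf.expectation V (\<lambda>\<pi>. (elim (pivoted \<pi>) k k j)\<^sup>2) \<le> real (Suc k) * dot {..<n} (a j) (a j)"
proof -
  let ?I = "{..<n}"
  define w where "w S = (ext_mul (a j) (wedge a k) S)\<^sup>2" for S
  define g where "g T = (\<Sum>x\<in>?I - T. w (insert x T) / (wedge a k T)\<^sup>2)" for T
  have "(elim (pivoted \<pi>) k k j)\<^sup>2 \<le> g (\<pi> ` {..<k})" if \<pi>: "\<pi> \<in> set_pmf V" for \<pi>
  proof -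
    have perm: "\<pi> permutes ?I" using permutes \<pi> by auto
    have inj: "inj \<pi>" using perm by (rule permutes_inj)
    have mem: "\<pi> k \<in> ?I - \<pi> ` {..<k}"
      using k permutes_in_image[OF perm, of k] inj by (auto simp: inj_eq)
    have "(elim (pivoted \<pi>) k k j)\<^sup>2 = w (insert (\<pi> k) (\<pi> ` {..<k})) / (wedge a k (\<pi> ` {..<k}))\<^sup>2"
      unfolding w_def using k by (intro elim_square[OF \<pi>]) auto
    also have "\<dots> \<le> g (\<pi> ` {..<k})"
      unfolding g_def
      by (rule member_le_sum[OF mem, where f = "\<lambda>x. w (insert x (\<pi> ` {..<k})) / (wedge a k (\<pi> ` {..<k}))\<^sup>2"])
        (auto simp: w_def)
    finally show ?thesis .
  qed
  then have "measure_pmf.expectation V (\<lambda>\<pi>. (elim (pivoted \<pi>) k k j)\<^sup>2)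
      \<le> measure_pmf.expectation V (\<lambda>\<pi>. g (\<pi> ` {..<k}))" by (rule expectation_mono)
  also have "\<dots> = (\<Sum>T\<in>Pow ?I. g T * (wedge a k T)\<^sup>2) / wedge_norm2 ?I a k"
    using k by (intro expectation_prefix) simp
  also have "\<dots> \<le> (real (Suc k) * dot ?I (a j) (a j) * wedge_norm2 ?I a k) / wedge_norm2 ?I a k"
  proof (rule divide_right_mono)
    have "(\<Sum>T\<in>Pow ?I. g T * (wedge a k T)\<^sup>2) \<le> (\<Sum>T\<in>Pow ?I. \<Sum>x\<in>?I - T. w (insert x T))"
      unfolding g_def sum_distrib_right by (intro sum_mono) (simp add: w_def)
    also have "\<dots> = (\<Sum>S\<in>Pow ?I. \<Sum>x\<in>S. w (insert x (S - {x})))"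
      by (rule sum_Pow_remove_eq_sum_Pow_insert[symmetric]) simp
    also have "\<dots> = (\<Sum>S\<in>Pow ?I. real (Suc k) * w S)"
    proof (rule sum.cong[OF refl])
      fix S assume "S \<in> Pow ?I"
      have "(\<Sum>x\<in>S. w (insert x (S - {x}))) = real (card S) * w S" by (simp add: insert_absorb)
      also have "\<dots> = real (Suc k) * w S"
      proof (cases "card S = Suc k")
        case False
        (* The multivector is a product of k + 1 vectors, so it has no coordinates in other degrees. *)
        have "wedge (a(k := a j)) (Suc k) S = 0" using False by (intro wedge_eq_0) simp
        moreover have "wedge (a(k := a j)) k = wedge a k" by (rule wedge_cong) simp
        ultimately have "ext_mul (a j) (wedge a k) S = 0" by simp
        then show ?thesis by (simp add: w_def)
      qed simp
      finally show "(\<Sum>x\<in>S. w (insert x (S - {x}))) = real (Suc k) * w S" .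
    qed
    also have "\<dots> = real (Suc k) * (\<Sum>S\<in>Pow ?I. w S)" by (simp only: sum_distrib_left)
    also have "\<dots> \<le> real (Suc k) * (dot ?I (a j) (a j) * wedge_norm2 ?I a k)"
      unfolding w_def wedge_norm2_def by (intro mult_left_mono ext_mul_norm_le) auto
    finally show "(\<Sum>T\<in>Pow ?I. g T * (wedge a k T)\<^sup>2) \<le> real (Suc k) * dot ?I (a j) (a j) * wedge_norm2 ?I a k"
      by (simp only: mult.assoc)
  qed (rule wedge_norm2_nonneg)
  also have "\<dots> = real (Suc k) * dot ?I (a j) (a j)" using norm_pos[of k] k by simp
  finally show ?thesis .
qed

end

section \<open>Matrix norms, growth, and the bounds for random pivoting\<close>

lemma frob_norm_square: "(frob_norm A)\<^sup>2 = (\<Sum>i<dim_row A. \<Sum>j<dim_col A. (A $$ (i, j))\<^sup>2)"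
  unfolding frob_norm_def by (intro real_sqrt_pow2 sum_nonneg) auto

lemma finite_elements_mat: "finite (elements_mat A)"
  by (simp add: elements_mat_def)

lemma max_norm_nonneg: "0 \<le> max_norm A"
  unfolding max_norm_def by (intro Max_ge) (auto simp: finite_elements_mat)

lemma abs_le_max_norm:
  assumes "i < dim_row A" "j < dim_col A"
  shows "\<bar>A $$ (i, j)\<bar> \<le> max_norm A"
proof -
  have "A $$ (i, j) \<in> elements_mat A" using assms by (intro elements_matI[of A]) auto
  then show ?thesis unfolding max_norm_def by (intro Max_ge) (auto simp: finite_elements_mat)
qed

lemma max_norm_le:
  assumes "0 \<le> c" "\<And>i j. i < dim_row A \<Longrightarrow> j < dim_col A \<Longrightarrow> \<bar>A $$ (i, j)\<bar> \<le> c"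
  shows "max_norm A \<le> c"
  unfolding max_norm_def
  by (subst Max_le_iff) (use assms in \<open>auto simp: finite_elements_mat\<close>)

lemma max_norm_le_frob_norm: "max_norm A \<le> frob_norm A"
proof (rule max_norm_le)
  show nn: "0 \<le> frob_norm A" unfolding frob_norm_def by (intro real_sqrt_ge_zero sum_nonneg) auto
  fix i j assume ij: "i < dim_row A" "j < dim_col A"
  have "(A $$ (i, j))\<^sup>2 \<le> (\<Sum>j<dim_col A. (A $$ (i, j))\<^sup>2)"
    using ij by (intro member_le_sum) auto
  also have "\<dots> \<le> (frob_norm A)\<^sup>2"
    unfolding frob_norm_square
    using ij by (intro member_le_sum[where f = "\<lambda>i. \<Sum>j<dim_col A. (A $$ (i, j))\<^sup>2"]) (auto intro: sum_nonneg)
  finally show "\<bar>A $$ (i, j)\<bar> \<le> frob_norm A" using nn by (simp add: abs_le_square_iff[symmetric])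
qed

lemma column_square_le_norm_1_2:
  assumes "j < dim_col A"
  shows "(\<Sum>i<dim_row A. (A $$ (i, j))\<^sup>2) \<le> (norm_1_2 A)\<^sup>2"
proof -
  let ?s = "\<Sum>i<dim_row A. (A $$ (i, j))\<^sup>2"
  have "sqrt ?s \<le> norm_1_2 A"
    unfolding norm_1_2_def by (rule Max_ge) (use assms in auto)
  then have "(sqrt ?s)\<^sup>2 \<le> (norm_1_2 A)\<^sup>2" by (intro power_mono) (auto intro: sum_nonneg)
  then show ?thesis by (simp add: sum_nonneg)
qed

lemma norm_1_2_square_le: "(norm_1_2 A)\<^sup>2 \<le> real (dim_row A) * (max_norm A)\<^sup>2"
proof -
  let ?c = "sqrt (real (dim_row A) * (max_norm A)\<^sup>2)"
  have "sqrt (\<Sum>i<dim_row A. (A $$ (i, j))\<^sup>2) \<le> ?c" if "j < dim_col A" for j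
  proof -
    have "(\<Sum>i<dim_row A. (A $$ (i, j))\<^sup>2) \<le> (\<Sum>i<dim_row A. (max_norm A)\<^sup>2)"
      using abs_le_max_norm that max_norm_nonneg[of A]
      by (intro sum_mono) (simp add: abs_le_square_iff[symmetric])
    then show ?thesis by simp
  qed
  then have "norm_1_2 A \<le> ?c"
    unfolding norm_1_2_def by (subst Max_le_iff) auto
  moreover have "0 \<le> norm_1_2 A" unfolding norm_1_2_def by (rule Max_ge) auto
  ultimately have "(norm_1_2 A)\<^sup>2 \<le> ?c\<^sup>2" by (intro power_mono)
  then show ?thesis by simp
qed

lemma perm_mat_mult:
  assumes A: "A \<in> carrier_mat n n" and \<pi>: "\<pi> permutes {..<n}"
  shows "perm_mat n \<pi> * A = mat n n (\<lambda>(i, j). A $$ (\<pi> i, j))"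
proof (rule eq_matI)
  fix i j assume "i < dim_row (mat n n (\<lambda>(i, j). A $$ (\<pi> i, j)))" "j < dim_col (mat n n (\<lambda>(i, j). A $$ (\<pi> i, j)))"
  then have ij: "i < n" "j < n" by auto
  have \<pi>i: "\<pi> i < n" using permutes_in_image[OF \<pi>, of i] ij by simp
  have "(perm_mat n \<pi> * A) $$ (i, j) = (\<Sum>l<n. (if l = \<pi> i then 1 else 0) * A $$ (l, j))"
    using ij A by (simp add: perm_mat_def scalar_prod_def atLeast0LessThan)
  also have "\<dots> = (\<Sum>l<n. if l = \<pi> i then A $$ (l, j) else 0)" by (rule sum.cong) auto
  also have "\<dots> = A $$ (\<pi> i, j)" using \<pi>i by simp
  finally show "(perm_mat n \<pi> * A) $$ (i, j) = mat n n (\<lambda>(i, j). A $$ (\<pi> i, j)) $$ (i, j)"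
    using ij by simp
qed (use A in \<open>auto simp: perm_mat_def\<close>)

lemma max_norm_perm_mat_mult:
  assumes A: "A \<in> carrier_mat n n" and \<pi>: "\<pi> permutes {..<n}"
  shows "max_norm (perm_mat n \<pi> * A) = max_norm A"
proof (rule antisym)
  note B = perm_mat_mult[OF A \<pi>]
  show "max_norm (perm_mat n \<pi> * A) \<le> max_norm A"
    unfolding B
  proof (rule max_norm_le[OF max_norm_nonneg])
    fix i j assume "i < dim_row (mat n n (\<lambda>(i, j). A $$ (\<pi> i, j)))" "j < dim_col (mat n n (\<lambda>(i, j). A $$ (\<pi> i, j)))"
    then have ij: "i < n" "j < n" by auto
    then have "\<pi> i < n" using permutes_in_image[OF \<pi>, of i] by simp
    then show "\<bar>mat n n (\<lambda>(i, j). A $$ (\<pi> i, j)) $$ (i, j)\<bar> \<le> max_norm A"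
      using abs_le_max_norm[of "\<pi> i" A j] A ij by simp
  qed
  show "max_norm A \<le> max_norm (perm_mat n \<pi> * A)"
  proof (rule max_norm_le[OF max_norm_nonneg])
    fix i j assume "i < dim_row A" "j < dim_col A"
    then have ij: "i < n" "j < n" using A by auto
    then obtain r where r: "r < n" "\<pi> r = i"
      using permutes_image[OF \<pi>] by (metis imageE lessThan_iff)
    then show "\<bar>A $$ (i, j)\<bar> \<le> max_norm (perm_mat n \<pi> * A)"
      using abs_le_max_norm[of r "mat n n (\<lambda>(i, j). A $$ (\<pi> i, j))" j] ij unfolding B by simp
  qed
qed

lemma invertible_mat_det_nonzero:
  assumes A: "(A :: real mat) \<in> carrier_mat n n" and inv: "invertible_mat A"
  shows "det A \<noteq> 0"
proof -
  obtain B where B: "A * B = 1\<^sub>m n" "B * A = 1\<^sub>m (dim_row B)"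
    using inv A unfolding invertible_mat_def inverts_mat_def by auto
  have "dim_row B = n" using arg_cong[OF B(2), of dim_col] A by simp
  moreover have "dim_col B = n" using arg_cong[OF B(1), of dim_col] by simp
  ultimately have "B \<in> carrier_mat n n" by auto
  then have "det A * det B = 1" using det_mult[OF A, of B] B(1) by simp
  then show ?thesis by auto
qed

text \<open>
  Bounding maximum norms by Frobenius norms, and the square of a maximum by the sum of the squares, reduces
  the growth bound to the expectations of the two Frobenius norms.
\<close>

lemma growth_square_le:
  assumes "has_LU B"
  shows "(growth B)\<^sup>2 \<le> ennreal ((frob_norm (LU_L B))\<^sup>2 + (frob_norm (LU_U B))\<^sup>2 / (max_norm B)\<^sup>2)"
proof -
  let ?l = "max_norm (LU_L B)" and ?u = "max_norm (LU_U B) / max_norm B"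
  have nn: "0 \<le> ?l" "0 \<le> ?u" using max_norm_nonneg by auto
  have "(growth B)\<^sup>2 = ennreal ((max ?l ?u)\<^sup>2)"
    using assms nn by (simp add: growth_def ennreal_power)
  also have "\<dots> \<le> ennreal (?l\<^sup>2 + ?u\<^sup>2)" by (intro ennreal_leI) (auto simp: max_def)
  also have "\<dots> \<le> ennreal ((frob_norm (LU_L B))\<^sup>2 + (frob_norm (LU_U B))\<^sup>2 / (max_norm B)\<^sup>2)"
    unfolding power_divide
    by (intro ennreal_leI add_mono divide_right_mono power_mono max_norm_le_frob_norm max_norm_nonneg) auto
  finally show ?thesis .
qed

lemma sum_Suc_mult_diff:
  "(\<Sum>k<m. real (Suc k) * (N - real k)) = N * real m * (real m + 1) / 2 - (real m - 1) * real m * (real m + 1) / 3"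
  by (induction m) (auto simp: field_simps)

context volume_sampling
begin

lemma expectation_frob_L:
  "measure_pmf.expectation V (\<lambda>\<pi>. (frob_norm (elim_L n (pivoted \<pi>)))\<^sup>2) \<le> (real n ^ 3 + 5 * real n) / 6"
proof -
  define col where "col k \<pi> = (\<Sum>i\<in>{Suc k..<n}. (elim (pivoted \<pi>) k i k / elim (pivoted \<pi>) k k k)\<^sup>2)" for k \<pi>
  have frob: "(frob_norm (elim_L n (pivoted \<pi>)))\<^sup>2 = (\<Sum>k<n. 1 + col k \<pi>)" if \<pi>: "\<pi> \<in> set_pmf V" for \<pi>
  proof -
    let ?f = "\<lambda>i k. (elim (pivoted \<pi>) k i k / elim (pivoted \<pi>) k k k)\<^sup>2"
    have "(frob_norm (elim_L n (pivoted \<pi>)))\<^sup>2 = (\<Sum>i<n. \<Sum>k<n. ?f i k)"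
      by (simp add: frob_norm_square elim_L_def)
    also have "\<dots> = (\<Sum>k<n. \<Sum>i<n. ?f i k)" by (rule sum.swap)
    also have "\<dots> = (\<Sum>k<n. 1 + col k \<pi>)"
    proof (rule sum.cong[OF refl])
      fix k assume "k \<in> {..<n}"
      then have k: "k < n" by simp
      have piv: "elim (pivoted \<pi>) l l l \<noteq> 0" if "l < n" for l by (rule pivot_nonzero[OF \<pi> that])
      have "?f i k = 0" if "i < k" for i
      proof -
        have "elim (pivoted \<pi>) k i k = 0" by (rule elim_eq_0) (use piv k that in auto)
        then show ?thesis by simp
      qed
      then have "(\<Sum>i<n. ?f i k) = (\<Sum>i\<in>{k..<n}. ?f i k)"
        by (intro sum.mono_neutral_right) auto
      also have "\<dots> = ?f k k + col k \<pi>"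
        using k by (simp add: col_def sum.atLeast_Suc_lessThan)
      also have "?f k k = 1" using piv[OF k] by simp
      finally show "(\<Sum>i<n. ?f i k) = 1 + col k \<pi>" .
    qed
    finally show ?thesis .
  qed
  have "measure_pmf.expectation V (\<lambda>\<pi>. (frob_norm (elim_L n (pivoted \<pi>)))\<^sup>2)
      \<le> measure_pmf.expectation V (\<lambda>\<pi>. \<Sum>k<n. 1 + col k \<pi>)"
    using frob by (intro expectation_mono) simp
  also have "\<dots> = (\<Sum>k<n. measure_pmf.expectation V (\<lambda>\<pi>. 1 + col k \<pi>))"
    by (rule expectation_sum)
  also have "\<dots> = (\<Sum>k<n. 1 + measure_pmf.expectation V (col k))"
    by (intro sum.cong refl, subst Bochner_Integration.integral_add)
      (auto intro: integrable_measure_pmf_finite[OF finite_support])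
  also have "\<dots> \<le> (\<Sum>k<n. 1 + real (Suc k) * ((real n - 1) - real k))"
  proof (rule sum_mono)
    fix k assume "k \<in> {..<n}"
    then have k: "k < n" by simp
    then have "measure_pmf.expectation V (col k) \<le> real (Suc k) * real (n - Suc k)"
      unfolding col_def by (rule expectation_L_column)
    also have "real (n - Suc k) = (real n - 1) - real k" using k by (simp add: of_nat_diff)
    finally show "1 + measure_pmf.expectation V (col k) \<le> 1 + real (Suc k) * ((real n - 1) - real k)" by simp
  qed
  also have "\<dots> = (real n ^ 3 + 5 * real n) / 6"
    unfolding sum.distrib sum_Suc_mult_diff by (simp add: field_simps power3_eq_cube)
  finally show ?thesis .
qed

lemma expectation_frob_U:
  assumes M: "\<And>j. j < n \<Longrightarrow> dot {..<n} (a j) (a j) \<le> M"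
  shows "measure_pmf.expectation V (\<lambda>\<pi>. (frob_norm (elim_U n (pivoted \<pi>)))\<^sup>2)
    \<le> (real n ^ 3 + 3 * (real n)\<^sup>2 + 2 * real n) / 6 * M"
proof -
  have frob: "(frob_norm (elim_U n (pivoted \<pi>)))\<^sup>2 = (\<Sum>k<n. \<Sum>j\<in>{k..<n}. (elim (pivoted \<pi>) k k j)\<^sup>2)"
    if \<pi>: "\<pi> \<in> set_pmf V" for \<pi>
  proof -
    have "(\<Sum>j<n. (elim (pivoted \<pi>) k k j)\<^sup>2) = (\<Sum>j\<in>{k..<n}. (elim (pivoted \<pi>) k k j)\<^sup>2)" if k: "k < n" for k
    proof (rule sum.mono_neutral_right)
      show "\<forall>j\<in>{..<n} - {k..<n}. (elim (pivoted \<pi>) k k j)\<^sup>2 = 0"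
      proof
        fix j assume "j \<in> {..<n} - {k..<n}"
        then have "elim (pivoted \<pi>) k k j = 0"
          using k pivot_nonzero[OF \<pi>] by (intro elim_eq_0) auto
        then show "(elim (pivoted \<pi>) k k j)\<^sup>2 = 0" by simp
      qed
    qed auto
    then show ?thesis by (simp add: frob_norm_square elim_U_def)
  qed
  have "measure_pmf.expectation V (\<lambda>\<pi>. (frob_norm (elim_U n (pivoted \<pi>)))\<^sup>2)
      \<le> measure_pmf.expectation V (\<lambda>\<pi>. \<Sum>k<n. \<Sum>j\<in>{k..<n}. (elim (pivoted \<pi>) k k j)\<^sup>2)"
    using frob by (intro expectation_mono) simp
  also have "\<dots> = (\<Sum>k<n. \<Sum>j\<in>{k..<n}. measure_pmf.expectation V (\<lambda>\<pi>. (elim (pivoted \<pi>) k k j)\<^sup>2))"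
    by (simp add: expectation_sum)
  also have "\<dots> \<le> (\<Sum>k<n. \<Sum>j\<in>{k..<n}. real (Suc k) * M)"
  proof (intro sum_mono)
    fix k j assume "k \<in> {..<n}" "j \<in> {k..<n}"
    then have k: "k < n" "j < n" by auto
    show "measure_pmf.expectation V (\<lambda>\<pi>. (elim (pivoted \<pi>) k k j)\<^sup>2) \<le> real (Suc k) * M"
      using expectation_U_entry[OF k(1), of j] mult_left_mono[OF M[OF k(2)], of "real (Suc k)"]
      by linarith
  qed
  also have "\<dots> = (\<Sum>k<n. real (Suc k) * (real n - real k)) * M"
    unfolding sum_distrib_right by (intro sum.cong) (auto simp: of_nat_diff)
  also have "\<dots> = (real n ^ 3 + 3 * (real n)\<^sup>2 + 2 * real n) / 6 * M"
    unfolding sum_Suc_mult_diff by (simp add: field_simps power3_eq_cube power2_eq_square)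
  finally show ?thesis .
qed

end

theorem theorem3p1:
  shows "\<exists>C::real. \<forall>(n::nat) (A::real mat). A \<in> carrier_mat n n \<and> invertible_mat A \<longrightarrow>
    (\<exists>Vol :: (nat \<Rightarrow> nat) pmf.
       set_pmf Vol \<subseteq> {\<pi>. \<pi> permutes {..<n}} \<and>
       (\<forall>k\<in>{1..n}. \<exists>c>0. \<forall>S. S \<subseteq> {..<n} \<and> card S = k \<longrightarrow>
          measure_pmf.prob Vol {\<pi>. \<pi> ` {..<k} = S} = c * (Determinant.det (submatrix A S {..<k}))\<^sup>2) \<and>
       (AE \<pi> in measure_pmf Vol. has_LU (perm_mat n \<pi> * A)) \<and>
       measure_pmf.expectation Vol (\<lambda>\<pi>. (frob_norm (LU_L (perm_mat n \<pi> * A)))\<^sup>2)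
         \<le> (real n ^ 3 + 5 * real n) / 6 \<and>
       measure_pmf.expectation Vol (\<lambda>\<pi>. (frob_norm (LU_U (perm_mat n \<pi> * A)))\<^sup>2)
         \<le> (real n ^ 3 + 3 * (real n)\<^sup>2 + 2 * real n) / 6 * (norm_1_2 A)\<^sup>2 \<and>
       (\<integral>\<^sup>+ \<pi>. (growth (perm_mat n \<pi> * A))\<^sup>2 \<partial>measure_pmf Vol)
         \<le> ennreal (real n ^ 4 / 6 + C * real n ^ 3))"
proof (intro exI[of _ 2] allI impI, elim conjE)
  fix n :: nat and A :: "real mat"
  assume A: "A \<in> carrier_mat n n" and inv: "invertible_mat A"
  define a where "a = (\<lambda>c r. A $$ (r, c))"
  have "det (mat n n (\<lambda>(r, c). a c (id r))) = det A"
    using A by (intro arg_cong[where f = det] eq_matI) (auto simp: a_def)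
  then have "(wedge a n {..<n})\<^sup>2 = (det A)\<^sup>2"
    using det_mat_square_eq_wedge_square[of id n a] by simp
  then have top: "wedge a n {..<n} \<noteq> 0" using invertible_mat_det_nonzero[OF A inv] by auto
  obtain V where perm: "set_pmf V \<subseteq> {\<pi>. \<pi> permutes {..<n}}"
    and marg: "\<forall>k\<le>n. map_pmf (\<lambda>\<pi>. \<pi> ` {..<k}) V = volume_pmf {..<n} a k"
    using volume_sampling_permutation_exists[OF top] by blast
  interpret volume_sampling n a V
    using top perm marg by unfold_locales auto
  let ?B = "\<lambda>\<pi>. perm_mat n \<pi> * A"
  have LU: "has_LU (?B \<pi>)" "LU_L (?B \<pi>) = elim_L n (pivoted \<pi>)" "LU_U (?B \<pi>) = elim_U n (pivoted \<pi>)"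
    if \<pi>: "\<pi> \<in> set_pmf V" for \<pi>
  proof -
    have "?B \<pi> = mat n n (\<lambda>(i, j). pivoted \<pi> i j)"
      using perm_mat_mult[OF A, of \<pi>] perm \<pi> unfolding a_def by auto
    then show "has_LU (?B \<pi>)" "LU_L (?B \<pi>) = elim_L n (pivoted \<pi>)" "LU_U (?B \<pi>) = elim_U n (pivoted \<pi>)"
      using LU_eq_elim[of n "pivoted \<pi>"] pivot_nonzero[OF \<pi>] by auto
  qed
  have marginals: "\<exists>c>0. \<forall>S. S \<subseteq> {..<n} \<and> card S = k \<longrightarrow>
      measure_pmf.prob V {\<pi>. \<pi> ` {..<k} = S} = c * (det (submatrix A S {..<k}))\<^sup>2" if "k \<in> {1..n}" for k
  proof (intro exI[of _ "1 / wedge_norm2 {..<n} a k"] conjI allI impI, goal_cases)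
    case 1
    show ?case using norm_pos[of k] that by simp
  next
    case (2 S)
    have "measure_pmf.prob V {\<pi>. \<pi> ` {..<k} = S} = pmf (map_pmf (\<lambda>\<pi>. \<pi> ` {..<k}) V) S"
      by (simp add: pmf_map vimage_def)
    also have "\<dots> = pmf (volume_pmf {..<n} a k) S" using marg that by simp
    also have "\<dots> = (wedge a k S)\<^sup>2 / wedge_norm2 {..<n} a k"
      using norm_pos[of k] that 2 by (simp add: pmf_volume_pmf)
    also have "(wedge a k S)\<^sup>2 = (det (submatrix A S {..<k}))\<^sup>2"
      using det_submatrix_square_eq_wedge_square[OF A] 2 by (simp add: a_def)
    finally show ?case by simp
  qed
  have EL: "measure_pmf.expectation V (\<lambda>\<pi>. (frob_norm (LU_L (?B \<pi>)))\<^sup>2) \<le> (real n ^ 3 + 5 * real n) / 6"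
    by (rule order_trans[OF expectation_mono expectation_frob_L]) (simp add: LU)
  have dot_le: "dot {..<n} (a j) (a j) \<le> (norm_1_2 A)\<^sup>2" if "j < n" for j
    using column_square_le_norm_1_2[of j A] A that by (simp add: dot_def a_def power2_eq_square)
  define K where "K = (real n ^ 3 + 3 * (real n)\<^sup>2 + 2 * real n) / 6"
  have EU: "measure_pmf.expectation V (\<lambda>\<pi>. (frob_norm (LU_U (?B \<pi>)))\<^sup>2) \<le> K * (norm_1_2 A)\<^sup>2"
    unfolding K_def
    by (rule order_trans[OF expectation_mono expectation_frob_U[OF dot_le]]) (simp_all add: LU)
  define m where "m = max_norm A"
  define F where "F \<pi> = (frob_norm (LU_L (?B \<pi>)))\<^sup>2 + (frob_norm (LU_U (?B \<pi>)))\<^sup>2 / m\<^sup>2" for \<pi>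
  have "(\<integral>\<^sup>+ \<pi>. (growth (?B \<pi>))\<^sup>2 \<partial>measure_pmf V) \<le> (\<integral>\<^sup>+ \<pi>. ennreal (F \<pi>) \<partial>measure_pmf V)"
  proof (rule nn_integral_mono_AE)
    have "(growth (?B \<pi>))\<^sup>2 \<le> ennreal (F \<pi>)" if "\<pi> \<in> set_pmf V" for \<pi>
      using growth_square_le[OF LU(1)[OF that]] max_norm_perm_mat_mult[OF A, of \<pi>] perm that
      by (auto simp: F_def m_def)
    then show "AE \<pi> in V. (growth (?B \<pi>))\<^sup>2 \<le> ennreal (F \<pi>)" by (simp add: AE_measure_pmf_iff)
  qed
  also have "\<dots> = ennreal (measure_pmf.expectation V F)"
    by (intro nn_integral_eq_integral integrable_measure_pmf_finite[OF finite_support]) (simp add: F_def)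
  also have "measure_pmf.expectation V F \<le> real n ^ 4 / 6 + 2 * real n ^ 3"
  proof -
    have K0: "0 \<le> K" unfolding K_def by simp
    have "measure_pmf.expectation V F = measure_pmf.expectation V (\<lambda>\<pi>. (frob_norm (LU_L (?B \<pi>)))\<^sup>2)
        + measure_pmf.expectation V (\<lambda>\<pi>. (frob_norm (LU_U (?B \<pi>)))\<^sup>2) / m\<^sup>2"
      unfolding F_def
      by (subst Bochner_Integration.integral_add) (simp_all add: integrable_measure_pmf_finite[OF finite_support])
    also have "\<dots> \<le> (real n ^ 3 + 5 * real n) / 6 + K * (norm_1_2 A)\<^sup>2 / m\<^sup>2"
      by (intro add_mono EL divide_right_mono EU) simp
    also have "K * (norm_1_2 A)\<^sup>2 / m\<^sup>2 \<le> K * real n"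
    (* The maximum norm vanishes only for n = 0, where the quotient is 0 by convention. *)
    proof (cases "m = 0")
      case False
      have "K * (norm_1_2 A)\<^sup>2 \<le> K * (real n * m\<^sup>2)"
        using norm_1_2_square_le[of A] A K0 unfolding m_def by (intro mult_left_mono) auto
      then show ?thesis using False by (simp add: divide_le_eq mult.assoc)
    qed (simp add: K0)
    also have "(real n ^ 3 + 5 * real n) / 6 + K * real n \<le> real n ^ 4 / 6 + 2 * real n ^ 3"
    proof -
      have "real n \<le> real n ^ 3" "(real n)\<^sup>2 \<le> real n ^ 3"
        using power_increasing[of 1 3 "real n"] power_increasing[of 2 3 "real n"]
        by (cases "n = 0"; simp)+
      moreover have "0 \<le> real n ^ 3" by simp
      (* The terms below the leading one have coefficients 1/6 + 5/6 + 1/2 + 1/3 = 11/6 in total,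
         so the constant 2 suffices. *)
      moreover have "(w + 5 * u) / 6 + (z + 3 * w + 2 * v) / 6 \<le> z / 6 + 2 * w"
        if "u \<le> w" "v \<le> w" "0 \<le> w" for u v w z :: real
        using that by argo
      moreover have "K * real n = (real n ^ 4 + 3 * real n ^ 3 + 2 * (real n)\<^sup>2) / 6"
        unfolding K_def by (simp add: field_simps power_numeral_reduce)
      ultimately show ?thesis by metis
    qed
    finally show ?thesis by simp
  qed
  finally have growth: "(\<integral>\<^sup>+ \<pi>. (growth (?B \<pi>))\<^sup>2 \<partial>measure_pmf V) \<le> ennreal (real n ^ 4 / 6 + 2 * real n ^ 3)"
    by (simp add: ennreal_leI)
  show "\<exists>Vol :: (nat \<Rightarrow> nat) pmf.
       set_pmf Vol \<subseteq> {\<pi>. \<pi> permutes {..<n}} \<and>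
       (\<forall>k\<in>{1..n}. \<exists>c>0. \<forall>S. S \<subseteq> {..<n} \<and> card S = k \<longrightarrow>
          measure_pmf.prob Vol {\<pi>. \<pi> ` {..<k} = S} = c * (det (submatrix A S {..<k}))\<^sup>2) \<and>
       (AE \<pi> in measure_pmf Vol. has_LU (?B \<pi>)) \<and>
       measure_pmf.expectation Vol (\<lambda>\<pi>. (frob_norm (LU_L (?B \<pi>)))\<^sup>2)
         \<le> (real n ^ 3 + 5 * real n) / 6 \<and>
       measure_pmf.expectation Vol (\<lambda>\<pi>. (frob_norm (LU_U (?B \<pi>)))\<^sup>2)
         \<le> (real n ^ 3 + 3 * (real n)\<^sup>2 + 2 * real n) / 6 * (norm_1_2 A)\<^sup>2 \<and>
       (\<integral>\<^sup>+ \<pi>. (growth (?B \<pi>))\<^sup>2 \<partial>measure_pmf Vol)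
         \<le> ennreal (real n ^ 4 / 6 + 2 * real n ^ 3)"
    using perm marginals LU(1) EL EU growth
    by (intro exI[of _ V]) (simp add: AE_measure_pmf_iff K_def)
qed

end
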